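(* Let $f:X\to X$ be a pointwise periodic homeomorphism of a compact metric space $X$ and let $A\in 2^X$. Then: (i) $\omega_{2^f}(A)$ contains a unique minimal set $M$ (for $2^f$). (ii) $\omega_{2^f}(A)$ is finite if and only if $M$ is finite. (iii) If moreover $\omega_{2^f}(A)$ is infinite, then $M$ is an adding machine.
   Context: $f$ is pointwise periodic if for every $x\in X$ there is an integer $n\geq 1$ with $f^n(x)=x$. $2^X$ is the space of nonempty closed subsets of $X$ with the Hausdorff metric, and $2^f:2^X\to 2^X$, $2^f(A)=f(A)$. For a continuous self-map $g$ of a compact metric space $Z$: the $\omega$-limit set of $z$ is $\omega_g(z)=\bigcap_{n\in\mathbb{N}}\overline{\{g^k(z):k\geq n\}}$; a subset $M\subset Z$ is minimal if it is nonempty, closed, $g$-invariant ($g(M)\subset M$) and no proper subset of $M$ has these properties. Adding machines: let $\alpha=(j_1,j_2,\dots)$ be a sequence of integers with each $j_i\geq 2$, and let $\Delta_\alpha$ be the set of all sequences $(x_1,x_2,\dots)$ with $x_i\in\{0,1,\dots,j_i-1\}$, with the metric $d_\alpha(x,y)=\sum_{i\geq 1}\delta(x_i,y_i)/2^i$, where $\delta(a,b)=0$ if $a=b$ and $1$ otherwise. Addition in $\Delta_\alpha$ is coordinatewise modulo $j_i$ with carry to the right: $(x_i)+(y_i)=(z_i)$ with $z_1=(x_1+y_1) \bmod j_1$, $z_2=(x_2+y_2+t_1)\bmod j_2$ where $t_1=0$ if $x_1+y_1<j_1$ and $t_1=1$ otherwise, and so on. Put $f_\alpha(x)=x+(1,0,0,\dots)$.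 The system $(\Delta_\alpha,f_\alpha)$ is called an adding machine. A closed $g$-invariant subset $M$ of $Z$ is called an adding machine if $(M,g|_M)$ is topologically conjugate to $(\Delta_\alpha,f_\alpha)$ for some such $\alpha$. *)

theory Defs
  imports "HOL-Analysis.Analysis"
begin

section \<open>Topological dynamics\<close>

definition pointwise_periodic_on :: "'a set \<Rightarrow> ('a \<Rightarrow> 'a) \<Rightarrow> bool" where
  "pointwise_periodic_on X f \<longleftrightarrow> (\<forall>x\<in>X. \<exists>n\<ge>1. (f ^^ n) x = x)"

definition omega_limit :: "'a topology \<Rightarrow> ('a \<Rightarrow> 'a) \<Rightarrow> 'a \<Rightarrow> 'a set" where
  "omega_limit Z g z = (\<Inter>n. Z closure_of {(g ^^ k) z | k. k \<ge> n})"

definition closed_invariant :: "'a topology \<Rightarrow> ('a \<Rightarrow> 'a) \<Rightarrow> 'a set \<Rightarrow> bool" where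
  "closed_invariant Z g M \<longleftrightarrow> closedin Z M \<and> g ` M \<subseteq> M"

definition minimal_set :: "'a topology \<Rightarrow> ('a \<Rightarrow> 'a) \<Rightarrow> 'a set \<Rightarrow> bool" where
  "minimal_set Z g M \<longleftrightarrow>
     M \<noteq> {} \<and> closed_invariant Z g M \<and>
     (\<forall>N. N \<subset> M \<longrightarrow> \<not> (N \<noteq> {} \<and> closed_invariant Z g N))"

definition topologically_conjugate ::
  "'a topology \<Rightarrow> ('a \<Rightarrow> 'a) \<Rightarrow> 'b topology \<Rightarrow> ('b \<Rightarrow> 'b) \<Rightarrow> bool" where
  "topologically_conjugate Y g Z h \<longleftrightarrow>
     (\<exists>\<phi>. homeomorphic_map Y Z \<phi> \<and> (\<forall>y\<in>topspace Y. \<phi> (g y) = h (\<phi> y)))"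

section \<open>The hyperspace of nonempty closed subsets\<close>

definition hyperspace :: "'a set \<Rightarrow> ('a \<Rightarrow> 'a \<Rightarrow> real) \<Rightarrow> 'a set set" where
  "hyperspace X d = {A. A \<noteq> {} \<and> closedin (Metric_space.mtopology X d) A}"

text \<open>The locale \<^locale>\<open>Metric_space\<close> asks for nonnegativity and symmetry off the carrier as well,
  hence the default value 0 there.\<close>

definition hausdorff_dist ::
  "'a set \<Rightarrow> ('a \<Rightarrow> 'a \<Rightarrow> real) \<Rightarrow> 'a set \<Rightarrow> 'a set \<Rightarrow> real" where
  "hausdorff_dist X d A B =
     (if A \<in> hyperspace X d \<and> B \<in> hyperspace X d
      then max (SUP a\<in>A. INF b\<in>B. d a b) (SUP b\<in>B. INF a\<in>A. d a b)
      else 0)"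

definition hyperspace_topology :: "'a set \<Rightarrow> ('a \<Rightarrow> 'a \<Rightarrow> real) \<Rightarrow> 'a set topology" where
  "hyperspace_topology X d = Metric_space.mtopology (hyperspace X d) (hausdorff_dist X d)"

definition induced_map :: "('a \<Rightarrow> 'a) \<Rightarrow> 'a set \<Rightarrow> 'a set" where
  "induced_map f A = f ` A"

lemma Metric_space_hyperspace:
  assumes "Metric_space X d" and "compact_space (Metric_space.mtopology X d)"
  shows "Metric_space (hyperspace X d) (hausdorff_dist X d)"
proof -
  interpret Metric_space X d by fact
  have "mbounded X"
    using assms(2) compactin_imp_mbounded unfolding compact_space_def by simp
  then obtain K where K: "\<And>x y. x \<in> X \<Longrightarrow> y \<in> X \<Longrightarrow> d x y \<le> K"
    unfolding mbounded_alt by blast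
  define h where "h = (\<lambda>A B. SUP a\<in>A. INF b\<in>B. d a b)"
  have sub: "A \<subseteq> X" if "A \<in> hyperspace X d" for A
    using that closedin_subset unfolding hyperspace_def by fastforce
  have ne: "A \<noteq> {}" if "A \<in> hyperspace X d" for A
    using that unfolding hyperspace_def by simp
  have bb: "bdd_below (d a ` B)" for a B
    by (rule bdd_belowI[of _ 0]) auto
  have inf_le: "(INF b\<in>B. d a b) \<le> d a b" if "b \<in> B" for a b B
    using cINF_lower[OF bb that] .
  have inf_nn: "0 \<le> (INF b\<in>B. d a b)" if "B \<noteq> {}" for a B
    by (rule cINF_greatest[OF that]) simp
  have ba: "bdd_above ((\<lambda>a. INF b\<in>B. d a b) ` A)"
    if "A \<in> hyperspace X d" "B \<in> hyperspace X d" for A B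
  proof -
    have "B \<noteq> {}" by (rule ne[OF that(2)])
    then obtain b where "b \<in> B" by blast
    then show ?thesis
      using inf_le[of b B] K sub[OF that(1)] sub[OF that(2)]
      by (intro bdd_aboveI2[of _ _ K]) (meson order_trans subsetD)
  qed
  have le_h: "(INF b\<in>B. d a b) \<le> h A B"
    if "A \<in> hyperspace X d" "B \<in> hyperspace X d" "a \<in> A" for A B a
    unfolding h_def using cSUP_upper[OF that(3) ba[OF that(1,2)]] .
  have h_nn: "0 \<le> h A B" if "A \<in> hyperspace X d" "B \<in> hyperspace X d" for A B
    using le_h[OF that] inf_nn[OF ne[OF that(2)]] ne[OF that(1)] by (meson ex_in_conv order_trans)
  have h_tri: "h A C \<le> h A B + h B C"
    if H: "A \<in> hyperspace X d" "B \<in> hyperspace X d" "C \<in> hyperspace X d" for A B C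
  proof -
    have "(INF c\<in>C. d a c) \<le> h A B + h B C" if a: "a \<in> A" for a
    proof -
      have "(INF c\<in>C. d a c) - h B C \<le> d a b" if b: "b \<in> B" for b
      proof -
        have "(INF c\<in>C. d a c) - d a b \<le> d b c" if c: "c \<in> C" for c
          using inf_le[OF c, of a] triangle[of a b c] a b c sub H by fastforce
        then have "(INF c\<in>C. d a c) - d a b \<le> (INF c\<in>C. d b c)"
          by (intro cINF_greatest[OF ne[OF H(3)]])
        with le_h[OF H(2,3) b] show ?thesis by linarith
      qed
      then have "(INF c\<in>C. d a c) - h B C \<le> (INF b\<in>B. d a b)"
        by (intro cINF_greatest[OF ne[OF H(2)]])
      with le_h[OF H(1,2) a] show ?thesis by linarith
    qed
    then have "(SUP a\<in>A. INF c\<in>C. d a c) \<le> h A B + h B C"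
      by (rule cSUP_least[OF ne[OF H(1)]])
    then show ?thesis by (simp add: h_def)
  qed
  have h_sub: "A \<subseteq> B"
    if H: "A \<in> hyperspace X d" "B \<in> hyperspace X d" and h0: "h A B \<le> 0" for A B
  proof
    fix a assume a: "a \<in> A"
    have "(INF b\<in>B. d a b) \<le> 0" using le_h[OF H a] h0 by linarith
    then have "\<exists>b\<in>B. b \<in> mball a r" if "r > 0" for r
      using that cINF_less_iff[OF ne[OF H(2)] bb, of a r] a sub[OF H(1)] sub[OF H(2)] by auto
    then have "a \<in> mtopology closure_of B"
      using a sub[OF H(1)] by (auto simp: metric_closure_of)
    then show "a \<in> B" using H(2) unfolding hyperspace_def by (simp add: closure_of_closedin)
  qed
  have h_refl: "h A A \<le> 0" if H: "A \<in> hyperspace X d" for A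
    unfolding h_def
  proof (rule cSUP_least[OF ne[OF H]])
    fix a assume a: "a \<in> A"
    then have "d a a = 0" using sub[OF H] by auto
    with inf_le[OF a, of a] show "(INF b\<in>A. d a b) \<le> 0" by simp
  qed
  have eq: "hausdorff_dist X d A B = max (h A B) (h B A)"
    if "A \<in> hyperspace X d" "B \<in> hyperspace X d" for A B
    using that unfolding hausdorff_dist_def h_def by (simp add: commute)
  show ?thesis
  proof
    show "0 \<le> hausdorff_dist X d A B" for A B
      using eq[of A B] h_nn[of A B] by (cases "A \<in> hyperspace X d \<and> B \<in> hyperspace X d")
        (auto simp: hausdorff_dist_def le_max_iff_disj)
    show "hausdorff_dist X d A B = hausdorff_dist X d B A" for A B
      using eq[of A B] eq[of B A] by (cases "A \<in> hyperspace X d \<and> B \<in> hyperspace X d")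
        (auto simp: hausdorff_dist_def max.commute)
    show "hausdorff_dist X d A B = 0 \<longleftrightarrow> A = B"
      if "A \<in> hyperspace X d" "B \<in> hyperspace X d" for A B
    proof
      assume "hausdorff_dist X d A B = 0"
      then have "h A B \<le> 0" "h B A \<le> 0" using eq[OF that] by linarith+
      then show "A = B" using h_sub that by blast
    next
      assume "A = B"
      then show "hausdorff_dist X d A B = 0"
        using eq[OF that] h_refl[OF that(1)] h_nn[OF that] by auto
    qed
    show "hausdorff_dist X d A C \<le> hausdorff_dist X d A B + hausdorff_dist X d B C"
      if "A \<in> hyperspace X d" "B \<in> hyperspace X d" "C \<in> hyperspace X d" for A B C
      using h_tri[of A B C] h_tri[of C B A] that eq by fastforce
  qed
qed

section \<open>Adding machines\<close>

text \<open>Sequences are indexed from 0, so coordinate \<open>i\<close> here is coordinate \<open>i + 1\<close> of the usual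
  notation \<open>(x\<^sub>1, x\<^sub>2, \<dots>)\<close>.\<close>

definition adding_space :: "(nat \<Rightarrow> nat) \<Rightarrow> (nat \<Rightarrow> nat) set" where
  "adding_space \<alpha> = {x. \<forall>i. x i < \<alpha> i}"

definition adding_dist :: "(nat \<Rightarrow> nat) \<Rightarrow> (nat \<Rightarrow> nat) \<Rightarrow> real" where
  "adding_dist x y = (\<Sum>i. (if x i = y i then 0 else 1) / 2 ^ Suc i)"

definition adding_topology :: "(nat \<Rightarrow> nat) \<Rightarrow> (nat \<Rightarrow> nat) topology" where
  "adding_topology \<alpha> = Metric_space.mtopology (adding_space \<alpha>) adding_dist"

primrec adding_carry ::
  "(nat \<Rightarrow> nat) \<Rightarrow> (nat \<Rightarrow> nat) \<Rightarrow> (nat \<Rightarrow> nat) \<Rightarrow> nat \<Rightarrow> nat" where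
  "adding_carry \<alpha> x y 0 = 0"
| "adding_carry \<alpha> x y (Suc i) = (if x i + y i + adding_carry \<alpha> x y i < \<alpha> i then 0 else 1)"

definition adding_plus ::
  "(nat \<Rightarrow> nat) \<Rightarrow> (nat \<Rightarrow> nat) \<Rightarrow> (nat \<Rightarrow> nat) \<Rightarrow> nat \<Rightarrow> nat" where
  "adding_plus \<alpha> x y = (\<lambda>i. (x i + y i + adding_carry \<alpha> x y i) mod \<alpha> i)"

definition adding_map :: "(nat \<Rightarrow> nat) \<Rightarrow> (nat \<Rightarrow> nat) \<Rightarrow> nat \<Rightarrow> nat" where
  "adding_map \<alpha> x = adding_plus \<alpha> x (\<lambda>i. if i = 0 then 1 else 0)"

definition adding_machine :: "'a topology \<Rightarrow> ('a \<Rightarrow> 'a) \<Rightarrow> 'a set \<Rightarrow> bool" where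
  "adding_machine Z g M \<longleftrightarrow>
     closed_invariant Z g M \<and>
     (\<exists>\<alpha>. (\<forall>i. 2 \<le> \<alpha> i) \<and>
       topologically_conjugate (subtopology Z M) g (adding_topology \<alpha>) (adding_map \<alpha>))"

lemma Metric_space_adding_space: "Metric_space (adding_space \<alpha>) adding_dist"
proof -
  define t :: "(nat \<Rightarrow> nat) \<Rightarrow> (nat \<Rightarrow> nat) \<Rightarrow> nat \<Rightarrow> real"
    where "t = (\<lambda>x y i. (if x i = y i then 0 else 1) / 2 ^ Suc i)"
  have geo: "summable (\<lambda>i. 1 / 2 ^ Suc i :: real)"
    using power_half_series by (simp add: sums_iff power_one_over)
  have t: "summable (t x y)" for x y
    by (rule summable_comparison_test'[OF geo, of 0]) (simp add: t_def)
  have t_nn: "0 \<le> t x y i" for x y i by (simp add: t_def)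
  have D: "adding_dist x y = suminf (t x y)" for x y
    by (simp add: adding_dist_def t_def)
  show ?thesis
  proof
    show "0 \<le> adding_dist x y" for x y
      unfolding D by (rule suminf_nonneg[OF t t_nn])
    show "adding_dist x y = adding_dist y x" for x y
      unfolding D by (rule arg_cong[of _ _ suminf]) (auto simp: t_def)
    show "adding_dist x y = 0 \<longleftrightarrow> x = y" for x y
      unfolding D suminf_eq_zero_iff[OF t t_nn] by (auto simp: t_def fun_eq_iff)
    show "adding_dist x z \<le> adding_dist x y + adding_dist y z" for x y z
    proof -
      have "t x z i \<le> t x y i + t y z i" for i by (simp add: t_def)
      then show ?thesis
        unfolding D suminf_add[OF t t] by (intro suminf_le t summable_add)
    qed
  qed
qed

end

theory Submission
  imports Defs
begin

text \<open>
  Every point of \<open>A\<close> is fixed by \<open>f\<^sup>n\<^sup>!\<close> for large \<open>n\<close>. Hence each \<open>B\<close> in \<open>\<omega>(A)\<close> has in its own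
  omega-limit set an element containing \<open>A\<close>, and every minimal set in \<open>\<omega>(A)\<close> dominates \<open>\<omega>(A)\<close> with
  respect to inclusion. An inclusion-maximal element of one minimal set therefore belongs to every
  other, which gives uniqueness.

  If \<open>E\<close> and \<open>D\<close> lie in the same minimal set of the \<open>n!\<close>-th power of \<open>2\<^sup>f\<close>, then \<open>D\<close> contains every
  \<open>x \<in> E\<close> with \<open>f\<^sup>n\<^sup>! x = x\<close>, as the sets containing \<open>x\<close> form a closed set invariant under that power.
  So the cyclic decompositions of \<open>M\<close> into minimal sets of these powers separate the points of \<open>M\<close>,
  and an infinite \<open>M\<close> is an adding machine.

  If \<open>M\<close> is finite, each \<open>B\<close> in \<open>\<omega>(A)\<close> lies below some \<open>D\<close> in \<open>M\<close>. If \<open>B\<close> were smaller than \<open>D\<close>, then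
  by Baire's theorem some nonempty relatively open subset of \<open>D - B\<close> would consist of points of a
  common period. There the iterates of \<open>A\<close> depend only on the exponent modulo that period, so they
  would meet it infinitely often along the sequence converging to \<open>B\<close>, at a common point.
\<close>

section \<open>Minimal sets\<close>

text \<open>A finite nonempty subfamily of a chain contains its own intersection, so the family has
  the finite intersection property.\<close>

lemma compact_space_chain_Inter:
  assumes "compact_space Z"
    and "\<And>C. C \<in> \<C> \<Longrightarrow> closedin Z C \<and> C \<noteq> {}"
    and chain: "\<And>C D. C \<in> \<C> \<Longrightarrow> D \<in> \<C> \<Longrightarrow> C \<subseteq> D \<or> D \<subseteq> C"
  shows "\<Inter>\<C> \<noteq> {}"
proof -
  have least: "\<Inter>\<F> \<in> \<F>" if "finite \<F>" "\<F> \<noteq> {}" "\<F> \<subseteq> \<C>" for \<F>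
    using that
  proof (induction rule: finite_ne_induct)
    case (insert C \<F>)
    then have IH: "\<Inter>\<F> \<in> \<F>" and "\<Inter>\<F> \<in> \<C>" "C \<in> \<C>" by blast+
    then have "C \<inter> \<Inter>\<F> = C \<or> C \<inter> \<Inter>\<F> = \<Inter>\<F>"
      using chain[of C "\<Inter>\<F>"] by (metis Int_absorb1 Int_absorb2)
    then show ?case using IH by (metis Inter_insert insertI1 insertI2)
  qed simp
  have "\<Inter>\<F> \<noteq> {}" if "finite \<F>" "\<F> \<subseteq> \<C>" for \<F>
  proof (cases "\<F> = {}")
    case False
    then have "\<Inter>\<F> \<in> \<C>" using least that by blast
    then show ?thesis using assms(2) by blast
  qed simp
  then show ?thesis
    using assms(2) by (intro assms(1)[unfolded compact_space_fip, rule_format]) simp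
qed

lemma closed_invariant_Int:
  "closed_invariant Z g M \<Longrightarrow> closed_invariant Z g N \<Longrightarrow> closed_invariant Z g (M \<inter> N)"
  by (auto simp: closed_invariant_def)

lemma closed_invariant_funpow:
  assumes "closed_invariant Z g M"
  shows "closed_invariant Z (g ^^ k) M"
proof -
  have "(g ^^ k) ` M \<subseteq> M"
    using assms unfolding closed_invariant_def by (induction k) auto
  then show ?thesis using assms by (simp add: closed_invariant_def)
qed

lemma minimal_setD:
  assumes "minimal_set Z g M"
  shows "M \<noteq> {}" "closed_invariant Z g M" "closedin Z M" "g ` M \<subseteq> M" "M \<subseteq> topspace Z"
proof -
  show "M \<noteq> {}" and inv: "closed_invariant Z g M"
    using assms unfolding minimal_set_def by blast+
  then show "closedin Z M" "g ` M \<subseteq> M" unfolding closed_invariant_def by blast+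
  then show "M \<subseteq> topspace Z" using closedin_subset by blast
qed

lemma minimal_set_eqI:
  "minimal_set Z g M \<Longrightarrow> closed_invariant Z g N \<Longrightarrow> N \<noteq> {} \<Longrightarrow> N \<subseteq> M \<Longrightarrow> N = M"
  unfolding minimal_set_def by (metis psubsetI)

lemma minimal_set_subset:
  assumes "minimal_set Z g M" "closed_invariant Z g N" "M \<inter> N \<noteq> {}"
  shows "M \<subseteq> N"
proof -
  have "M \<inter> N = M"
    using minimal_set_eqI[OF assms(1) closed_invariant_Int[OF minimal_setD(2)[OF assms(1)] assms(2)] assms(3)] by auto
  then show ?thesis by blast
qed

lemma minimal_set_disjoint:
  assumes "minimal_set Z g M" "minimal_set Z g N" "M \<inter> N \<noteq> {}"
  shows "M = N"
  using minimal_set_subset[OF assms(1) minimal_setD(2)[OF assms(2)]]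
    minimal_set_subset[OF assms(2) minimal_setD(2)[OF assms(1)]] assms(3) by blast

text \<open>Zorn's lemma supplies maximal elements, so it is applied to the complements of closed
  invariant sets. The union of a chain of complements is again of this kind because, by compactness,
  the corresponding intersection is nonempty.\<close>

lemma minimal_set_exists:
  assumes Z: "compact_space Z" and K: "closed_invariant Z g K" "K \<noteq> {}"
  obtains M where "M \<subseteq> K" "minimal_set Z g M"
proof -
  define \<N> where "\<N> = {N. N \<noteq> {} \<and> N \<subseteq> K \<and> closed_invariant Z g N}"
  have sub: "N \<subseteq> topspace Z" if "N \<in> \<N>" for N
    using that by (auto simp: \<N>_def closed_invariant_def dest: closedin_subset)
  have "\<exists>U\<in>(-) (topspace Z) ` \<N>. \<forall>X\<in>(-) (topspace Z) ` \<N>. U \<subseteq> X \<longrightarrow> X = U"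
  proof (rule subset_Zorn_nonempty)
    show "(-) (topspace Z) ` \<N> \<noteq> {}" using K by (auto simp: \<N>_def)
    fix \<C> assume ne: "\<C> \<noteq> {}" and ch: "subset.chain ((-) (topspace Z) ` \<N>) \<C>"
    define \<D> where "\<D> = (-) (topspace Z) ` \<C>"
    have \<C>sub: "\<C> \<subseteq> (-) (topspace Z) ` \<N>"
      using ch by (auto simp: subset.chain_def)
    have inv: "topspace Z - (topspace Z - N) = N" if "N \<in> \<N>" for N
      using sub[OF that] by blast
    have \<D>sub: "\<D> \<subseteq> \<N>"
    proof
      fix D assume "D \<in> \<D>"
      then obtain N where "N \<in> \<N>" "D = topspace Z - (topspace Z - N)"
        using \<C>sub unfolding \<D>_def by blast
      then show "D \<in> \<N>" using inv by simp
    qed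
    have "\<Inter>\<D> \<noteq> {}"
    proof (rule compact_space_chain_Inter[OF Z])
      show "closedin Z C \<and> C \<noteq> {}" if "C \<in> \<D>" for C
        using that \<D>sub by (auto simp: \<N>_def closed_invariant_def)
      show "C \<subseteq> D \<or> D \<subseteq> C" if CD: "C \<in> \<D>" "D \<in> \<D>" for C D
      proof -
        obtain C' D' where C': "C' \<in> \<C>" "C = topspace Z - C'" and D': "D' \<in> \<C>" "D = topspace Z - D'"
          using CD by (auto simp: \<D>_def)
        have "C' \<subseteq> D' \<or> D' \<subseteq> C'"
          using ch C'(1) D'(1) unfolding subset.chain_def by blast
        then show ?thesis using C' D' by blast
      qed
    qed
    moreover have "\<D> \<noteq> {}" using ne by (simp add: \<D>_def)
    moreover have "closedin Z (\<Inter>\<D>)"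
      using \<D>sub \<open>\<D> \<noteq> {}\<close> by (intro closedin_Inter) (auto simp: \<N>_def closed_invariant_def)
    moreover have "g ` \<Inter>\<D> \<subseteq> \<Inter>\<D>"
    proof (rule Inter_greatest)
      fix D assume D: "D \<in> \<D>"
      then have "g ` D \<subseteq> D" using \<D>sub by (auto simp: \<N>_def closed_invariant_def)
      then show "g ` \<Inter>\<D> \<subseteq> D" using D by blast
    qed
    moreover have "\<Inter>\<D> \<subseteq> K"
      using \<D>sub \<open>\<D> \<noteq> {}\<close> unfolding \<N>_def by blast
    ultimately have "\<Inter>\<D> \<in> \<N>"
      by (simp add: \<N>_def closed_invariant_def)
    moreover have "\<Union>\<C> = topspace Z - \<Inter>\<D>"
    proof -
      have "C \<subseteq> topspace Z" if "C \<in> \<C>" for C using \<C>sub that by blast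
      then show ?thesis by (auto simp: \<D>_def)
    qed
    ultimately show "\<Union>\<C> \<in> (-) (topspace Z) ` \<N>" by blast
  qed
  then obtain M where M: "M \<in> \<N>"
    and max: "\<And>N. N \<in> \<N> \<Longrightarrow> topspace Z - M \<subseteq> topspace Z - N \<Longrightarrow> topspace Z - N = topspace Z - M"
    by auto
  have "minimal_set Z g M"
    unfolding minimal_set_def
  proof (intro conjI allI impI)
    show "M \<noteq> {}" "closed_invariant Z g M" using M by (auto simp: \<N>_def)
    fix N assume N: "N \<subset> M"
    show "\<not> (N \<noteq> {} \<and> closed_invariant Z g N)"
    proof
      assume "N \<noteq> {} \<and> closed_invariant Z g N"
      then have "N \<in> \<N>" using M N by (auto simp: \<N>_def)
      from max[OF this] N sub[OF this] sub[OF M] show False by blast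
    qed
  qed
  with M that show ?thesis by (auto simp: \<N>_def)
qed

section \<open>Minimal sets of powers of a map\<close>

lemma continuous_map_funpow:
  "continuous_map Z Z g \<Longrightarrow> continuous_map Z Z (g ^^ k)"
  by (induction k) (simp_all add: continuous_map_compose)

lemma closedin_funpow_image:
  assumes "compact_space Z" "Hausdorff_space Z" "continuous_map Z Z g" "closedin Z N"
  shows "closedin Z ((g ^^ k) ` N)"
  by (rule compactin_imp_closedin[OF assms(2) image_compactin[OF closedin_compact_space[OF assms(1,4)]
        continuous_map_funpow[OF assms(3)]]])

lemma funpow_image_add: "(g ^^ (j + k)) ` N = (g ^^ j) ` (g ^^ k) ` N"
  by (simp add: funpow_add image_comp)

lemma funpow_commuting_apply: "(g ^^ j) ((g ^^ k) x) = (g ^^ k) ((g ^^ j) x)"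
  by (metis add.commute comp_apply funpow_add)

text \<open>Iterates commute, so a closed invariant \<open>K\<close> in the image pulls back to the
  closed invariant subset \<open>L\<close> of \<open>N\<close>; minimality gives
  \<open>L = N\<close>, and then \<open>K\<close> is the whole image.\<close>

lemma minimal_set_funpow_image:
  assumes Z: "compact_space Z" "Hausdorff_space Z" "continuous_map Z Z g"
    and N: "minimal_set Z (g ^^ p) N"
  shows "minimal_set Z (g ^^ p) ((g ^^ t) ` N)"
  unfolding minimal_set_def
proof (intro conjI allI impI)
  have "(g ^^ p) ` (g ^^ t) ` N = (g ^^ t) ` (g ^^ p) ` N"
    by (simp add: add.commute flip: funpow_image_add)
  also have "\<dots> \<subseteq> (g ^^ t) ` N"
    using minimal_setD(4)[OF N] by blast
  finally show "closed_invariant Z (g ^^ p) ((g ^^ t) ` N)"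
    using closedin_funpow_image[OF Z minimal_setD(3)[OF N]] by (simp add: closed_invariant_def)
  show "(g ^^ t) ` N \<noteq> {}" using minimal_setD(1)[OF N] by simp
  fix K assume KN: "K \<subset> (g ^^ t) ` N"
  show "\<not> (K \<noteq> {} \<and> closed_invariant Z (g ^^ p) K)"
  proof
    assume K: "K \<noteq> {} \<and> closed_invariant Z (g ^^ p) K"
    define L where "L = {x \<in> topspace Z. (g ^^ t) x \<in> K} \<inter> N"
    have "closedin Z L"
      unfolding L_def using K minimal_setD(3)[OF N] continuous_map_funpow[OF Z(3)]
      by (intro closedin_Int closedin_continuous_map_preimage[of Z Z]) (auto simp: closed_invariant_def)
    moreover have "(g ^^ p) ` L \<subseteq> L"
    proof
      fix y assume "y \<in> (g ^^ p) ` L"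
      then obtain x where x: "x \<in> L" "y = (g ^^ p) x" by blast
      then have "y \<in> N" using minimal_setD(4)[OF N] by (auto simp: L_def)
      moreover have "(g ^^ t) y = (g ^^ p) ((g ^^ t) x)"
        using x(2) funpow_commuting_apply[of t g p] by simp
      ultimately show "y \<in> L"
        using x K minimal_setD(5)[OF N] by (auto simp: L_def closed_invariant_def)
    qed
    moreover have "L \<noteq> {}"
      using K KN minimal_setD(5)[OF N] by (auto simp: L_def)
    ultimately have "L = N"
      by (intro minimal_set_eqI[OF N]) (auto simp: closed_invariant_def L_def)
    then show False using KN by (auto simp: L_def)
  qed
qed

lemma minimal_set_image_eq:
  assumes Z: "compact_space Z" "Hausdorff_space Z" "continuous_map Z Z g"
    and N: "minimal_set Z (g ^^ p) N"
  shows "(g ^^ p) ` N = N"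
  by (rule minimal_set_disjoint[OF minimal_set_funpow_image[OF Z N] N])
    (use minimal_setD(1,4)[OF N] in auto)

text \<open>The images of \<open>N\<close> are minimal for \<open>g ^^ p\<close>, hence equal or
  disjoint, and \<open>q\<close> is the first return time of \<open>N\<close>. The finite union over
  one period is closed and \<open>g\<close>-invariant, so it is all of \<open>M\<close>.\<close>

lemma minimal_set_power_cycle:
  assumes Z: "compact_space Z" "Hausdorff_space Z" "continuous_map Z Z g"
    and M: "minimal_set Z g M" and N: "minimal_set Z (g ^^ p) N" "N \<subseteq> M" and p: "p \<ge> 1"
  obtains q where "q \<ge> 1" "q dvd p" "M = (\<Union>t<q. (g ^^ t) ` N)"
    "\<And>s t. (g ^^ s) ` N \<inter> (g ^^ t) ` N \<noteq> {} \<longleftrightarrow> s mod q = t mod q"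
    "\<And>s t. s mod q = t mod q \<Longrightarrow> (g ^^ s) ` N = (g ^^ t) ` N"
proof -
  define q where "q = (LEAST q. q \<ge> 1 \<and> (g ^^ q) ` N = N)"
  have q: "q \<ge> 1 \<and> (g ^^ q) ` N = N"
    unfolding q_def by (rule LeastI[of _ p]) (use p minimal_set_image_eq[OF Z N(1)] in auto)
  have q_le: "q \<le> k" if "k \<ge> 1" "(g ^^ k) ` N = N" for k
    unfolding q_def by (rule Least_le) (use that in auto)
  have mult: "(g ^^ (q * a)) ` N = N" for a
    by (induction a) (use q in \<open>simp_all add: funpow_image_add\<close>)
  have red: "(g ^^ k) ` N = (g ^^ (k mod q)) ` N" for k
  proof -
    have "(g ^^ k) ` N = (g ^^ (k mod q)) ` (g ^^ (q * (k div q))) ` N"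
      by (simp flip: funpow_image_add)
    then show ?thesis by (simp only: mult)
  qed
  have dvd: "q dvd k" if "(g ^^ k) ` N = N" for k
  proof (rule ccontr)
    assume "\<not> q dvd k"
    then have "k mod q \<ge> 1" by (simp add: dvd_eq_mod_eq_0)
    moreover have "(g ^^ (k mod q)) ` N = N" using that red by simp
    ultimately have "q \<le> k mod q" by (rule q_le)
    moreover have "k mod q < q" using q by simp
    ultimately show False by simp
  qed
  have le: "s mod q = t mod q" if "(g ^^ s) ` N = (g ^^ t) ` N" "s \<le> t" for s t
  proof -
    \<comment> \<open>\<open>g ^^ s\<close> may fail to be injective and is not cancelled:
      \<open>g ^^ (s * (q - 1))\<close> completes its exponent to a multiple of \<open>q\<close>,
      and such an iterate returns \<open>N\<close> to itself.\<close>
    have "s * q = s * (q - 1) + s"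
      using q by (cases q) auto
    then have "N = (g ^^ (s * (q - 1))) ` (g ^^ s) ` N"
      using mult[of s] by (simp add: mult.commute flip: funpow_image_add)
    also have "\<dots> = (g ^^ (s * (q - 1) + t)) ` N"
      by (simp only: that(1) funpow_image_add)
    also have "s * (q - 1) + t = (t - s) + q * s"
      using \<open>s * q = _\<close> that(2) by (simp add: mult.commute)
    also have "(g ^^ ((t - s) + q * s)) ` N = (g ^^ (t - s)) ` N"
      by (simp only: funpow_image_add mult)
    finally have "q dvd t - s" using dvd by metis
    then show ?thesis using that(2) by (metis mod_eq_dvd_iff_nat)
  qed
  have iff: "(g ^^ s) ` N \<inter> (g ^^ t) ` N \<noteq> {} \<longleftrightarrow> s mod q = t mod q" for s t
  proof
    assume "(g ^^ s) ` N \<inter> (g ^^ t) ` N \<noteq> {}"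
    then have "(g ^^ s) ` N = (g ^^ t) ` N"
      by (intro minimal_set_disjoint[OF minimal_set_funpow_image[OF Z N(1)] minimal_set_funpow_image[OF Z N(1)]])
    then show "s mod q = t mod q" using le[of s t] le[of t s] nat_le_linear[of s t] by argo
  next
    assume "s mod q = t mod q"
    then have "(g ^^ s) ` N = (g ^^ t) ` N" using red by metis
    then show "(g ^^ s) ` N \<inter> (g ^^ t) ` N \<noteq> {}" using minimal_setD(1)[OF N(1)] by simp
  qed
  have "M = (\<Union>t<q. (g ^^ t) ` N)"
  proof (rule sym, rule minimal_set_eqI[OF M])
    show "(\<Union>t<q. (g ^^ t) ` N) \<noteq> {}"
      using q minimal_setD(1)[OF N(1)] by (auto intro!: exI[of _ 0])
    show "(\<Union>t<q. (g ^^ t) ` N) \<subseteq> M"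
    proof (rule UN_least)
      fix t
      have "(g ^^ t) ` M \<subseteq> M"
        using closed_invariant_funpow[OF minimal_setD(2)[OF M]] by (simp add: closed_invariant_def)
      then show "(g ^^ t) ` N \<subseteq> M" using N(2) by blast
    qed
    have "g ` (g ^^ t) ` N \<subseteq> (\<Union>t<q. (g ^^ t) ` N)" for t
    proof -
      have "g ` (g ^^ t) ` N = (g ^^ (Suc t mod q)) ` N"
        using red[of "Suc t"] by (simp add: image_comp)
      moreover have "Suc t mod q < q" using q by simp
      ultimately show ?thesis by blast
    qed
    moreover have "closedin Z (\<Union>t<q. (g ^^ t) ` N)"
      by (intro closedin_Union) (auto intro: closedin_funpow_image[OF Z minimal_setD(3)[OF N(1)]])
    ultimately show "closed_invariant Z g (\<Union>t<q. (g ^^ t) ` N)"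
      unfolding closed_invariant_def image_UN by blast
  qed
  moreover have "(g ^^ s) ` N = (g ^^ t) ` N" if "s mod q = t mod q" for s t
    using red[of s] red[of t] that by simp
  ultimately show ?thesis
    by (rule that[OF conjunct1[OF q] dvd[OF minimal_set_image_eq[OF Z N(1)]] _ iff])
qed

section \<open>Recognising adding machines\<close>

text \<open>The first \<open>n\<close> terms vanish and the rest are bounded by a geometric tail
  with sum \<open>(1 / 2) ^ n\<close>.\<close>

lemma adding_dist_le:
  assumes agree: "\<And>i. i < n \<Longrightarrow> x i = y i"
  shows "adding_dist x y \<le> (1 / 2) ^ n"
proof -
  define t :: "nat \<Rightarrow> real" where "t = (\<lambda>i. (if x i = y i then 0 else 1) / 2 ^ Suc i)"
  have geo: "(\<lambda>i. (1 / 2) ^ Suc i :: real) sums 1"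
    by (rule power_half_series)
  have t_le: "t i \<le> (1 / 2) ^ Suc i" for i
    by (simp add: t_def power_one_over field_simps)
  have t: "summable t"
    by (rule summable_comparison_test'[OF sums_summable[OF geo], of 0])
      (simp add: t_def power_one_over field_simps)
  have "(\<Sum>i<n. t i) = 0"
    by (simp add: t_def agree)
  then have "suminf t = (\<Sum>i. t (i + n))"
    using suminf_split_initial_segment[OF t, of n] by simp
  also have "\<dots> \<le> (\<Sum>i. (1 / 2) ^ n * (1 / 2) ^ Suc i)"
  proof (rule suminf_le)
    show "t (i + n) \<le> (1 / 2) ^ n * (1 / 2) ^ Suc i" for i
      using t_le[of "i + n"] by (simp add: power_add mult_ac)
    show "summable (\<lambda>i. t (i + n))" using t by (simp add: summable_iff_shift)
    show "summable (\<lambda>i. (1 / 2) ^ n * (1 / 2 :: real) ^ Suc i)"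
      by (rule summable_mult[OF sums_summable[OF geo]])
  qed
  also have "\<dots> = (1 / 2) ^ n"
    using sums_unique[OF sums_mult[OF geo, of "(1 / 2) ^ n"]] by simp
  finally show ?thesis by (simp add: adding_dist_def t_def)
qed

text \<open>The number \<open>T i x\<close> is the position of \<open>x\<close> modulo \<open>q i\<close>; its mixed
  radix digits are the coordinates of the conjugacy.\<close>

lemma adding_machineI:
  fixes T :: "nat \<Rightarrow> 'a \<Rightarrow> nat"
  assumes Z: "compact_space Z" and M: "closed_invariant Z g M" "M \<noteq> {}"
    and q0: "q 0 = 1" and q: "\<And>i. q i dvd q (Suc i)" "\<And>i. q i < q (Suc i)"
    and T_less: "\<And>i x. x \<in> M \<Longrightarrow> T i x < q i"
    and T_step: "\<And>i x. x \<in> M \<Longrightarrow> T i (g x) = Suc (T i x) mod q i"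
    and T_mod: "\<And>i x. x \<in> M \<Longrightarrow> T (Suc i) x mod q i = T i x"
    and T_closed: "\<And>i t. closedin Z {x \<in> M. T i x = t}"
    and T_sep: "\<And>x y. x \<in> M \<Longrightarrow> y \<in> M \<Longrightarrow> (\<And>i. T i x = T i y) \<Longrightarrow> x = y"
  shows "adding_machine Z g M"
proof -
  define \<alpha> where "\<alpha> i = q (Suc i) div q i" for i
  define \<phi> where "\<phi> x i = T (Suc i) x div q i" for x i
  have q_pos: "q i > 0" for i
    using q0 q(2)[of "i - 1"] by (cases i) auto
  have q_Suc: "q (Suc i) = \<alpha> i * q i" for i
    using q(1)[of i] by (simp add: \<alpha>_def)
  have \<alpha>_ge: "2 \<le> \<alpha> i" for i
  proof (rule ccontr)
    assume "\<not> 2 \<le> \<alpha> i"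
    then have "\<alpha> i \<le> 1" by simp
    then have "\<alpha> i * q i \<le> 1 * q i" by (rule mult_le_mono1)
    then show False using q_Suc[of i] q(2)[of i] by simp
  qed
  have gM: "g x \<in> M" if "x \<in> M" for x
    using M that by (auto simp: closed_invariant_def)
  have Msub: "M \<subseteq> topspace Z"
    using M closedin_subset by (auto simp: closed_invariant_def)
  have T_Suc: "T (Suc i) x = T i x + \<phi> x i * q i" if "x \<in> M" for i x
    using T_mod[OF that, of i] div_mult_mod_eq[of "T (Suc i) x" "q i"] by (simp add: \<phi>_def)
  have T0: "T 0 x = 0" if "x \<in> M" for x
    using T_less[OF that, of 0] q0 by simp
  have \<phi>_less: "\<phi> x i < \<alpha> i" if "x \<in> M" for x i
    using T_less[OF that, of "Suc i"] by (simp add: \<phi>_def q_Suc less_mult_imp_div_less)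
  interpret A: Metric_space "adding_space \<alpha>" adding_dist
    by (rule Metric_space_adding_space)
  have \<phi>_in: "\<phi> x \<in> adding_space \<alpha>" if "x \<in> M" for x
    using \<phi>_less[OF that] by (simp add: adding_space_def)
  have T_det: "T i x = T i y" if "x \<in> M" "y \<in> M" "T n x = T n y" "i \<le> n" for x y i n
    using that(4,3)
  proof (induction n)
    case (Suc n)
    show ?case
    proof (cases "i = Suc n")
      case False
      have "T n x = T n y"
        using T_mod[OF that(1), of n] T_mod[OF that(2), of n] Suc.prems(2) by simp
      then show ?thesis using Suc False by simp
    qed (use Suc in simp)
  qed simp
  \<comment> \<open>Finitely many closed level sets partition \<open>M\<close>, so each of them is
    also open in \<open>M\<close>.\<close>
  have T_open: "openin (subtopology Z M) {x \<in> M. T n x = t}" for n t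
  proof -
    have "{x \<in> M. T n x = t} = topspace (subtopology Z M) - (\<Union>s\<in>{..<q n} - {t}. {x \<in> M. T n x = s})"
      using T_less[of _ n] Msub by auto
    moreover have "closedin (subtopology Z M) (\<Union>s\<in>{..<q n} - {t}. {x \<in> M. T n x = s})"
    proof (rule closedin_Union)
      fix S assume "S \<in> (\<lambda>s. {x \<in> M. T n x = s}) ` ({..<q n} - {t})"
      then obtain s where "S = {x \<in> M. T n x = s}" by blast
      then show "closedin (subtopology Z M) S"
        using T_closed[of n s] by (auto intro: closedin_subset_topspace)
    qed simp
    ultimately show ?thesis by (simp only: openin_diff openin_topspace)
  qed
  have cont: "continuous_map (subtopology Z M) (adding_topology \<alpha>) \<phi>"
    unfolding adding_topology_def A.continuous_map_to_metric
  proof (intro ballI allI impI)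
    fix x \<epsilon> assume "x \<in> topspace (subtopology Z M)" "(0::real) < \<epsilon>"
    then have x: "x \<in> M" and "\<epsilon> > 0" by auto
    obtain n where n: "(1 / 2 :: real) ^ n < \<epsilon>"
      using real_arch_pow_inv[OF \<open>\<epsilon> > 0\<close>, of "1 / 2"] by auto
    have "\<phi> y \<in> A.mball (\<phi> x) \<epsilon>" if y: "y \<in> M" "T n y = T n x" for y
    proof -
      have "\<phi> x i = \<phi> y i" if "i < n" for i
        using T_det[OF x y(1) y(2)[symmetric], of "Suc i"] that by (simp add: \<phi>_def)
      then have "adding_dist (\<phi> x) (\<phi> y) < \<epsilon>"
        using adding_dist_le[of n "\<phi> x" "\<phi> y"] n by simp
      then show ?thesis using \<phi>_in[OF x] \<phi>_in[OF y(1)] by simp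
    qed
    then show "\<exists>U. openin (subtopology Z M) U \<and> x \<in> U \<and> (\<forall>y\<in>U. \<phi> y \<in> A.mball (\<phi> x) \<epsilon>)"
      using T_open[of n "T n x"] x by (intro exI[of _ "{y \<in> M. T n y = T n x}"]) auto
  qed
  have inj: "inj_on \<phi> M"
  proof (rule inj_onI)
    fix x y assume xy: "x \<in> M" "y \<in> M" "\<phi> x = \<phi> y"
    have "T i x = T i y" for i
      by (induction i) (simp_all add: T0 T_Suc xy)
    then show "x = y" by (rule T_sep[OF xy(1,2)])
  qed
  have hit: "\<exists>x\<in>M. T i x = t" if "t < q i" for i t
  proof -
    obtain x0 where x0: "x0 \<in> M" using M by blast
    have orb: "(g ^^ k) x0 \<in> M \<and> T i ((g ^^ k) x0) = (T i x0 + k) mod q i" for k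
    proof (induction k)
      case 0 then show ?case using x0 T_less[OF x0, of i] by simp
    next
      case (Suc k) then show ?case using gM T_step by (simp add: mod_Suc_eq)
    qed
    \<comment> \<open>Each step advances the position by one, so this waiting time leads from
      \<open>T i x0\<close> past \<open>q i\<close> to \<open>t\<close>.\<close>
    define k where "k = q i - T i x0 + t"
    have "T i x0 + k = q i + t"
      using T_less[OF x0, of i] by (simp add: k_def)
    then show ?thesis using orb[of k] that by (intro bexI[of _ "(g ^^ k) x0"]) auto
  qed
  have surj: "\<phi> ` M = adding_space \<alpha>"
  proof
    show "\<phi> ` M \<subseteq> adding_space \<alpha>" using \<phi>_in by blast
    show "adding_space \<alpha> \<subseteq> \<phi> ` M"
    proof
      fix a assume a: "a \<in> adding_space \<alpha>"
      \<comment> \<open>The truncations of the digit sequence \<open>a\<close> prescribe nested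
        nonempty closed level sets; a point common to all of them has the digits
        \<open>a\<close>.\<close>
      define s where "s i = (\<Sum>j<i. a j * q j)" for i
      have s_less: "s i < q i" for i
      proof (induction i)
        case 0 then show ?case using q_pos by (simp add: s_def)
      next
        case (Suc i)
        have "s (Suc i) < q i + a i * q i" using Suc by (simp add: s_def)
        also have "\<dots> = Suc (a i) * q i" by simp
        also have "\<dots> \<le> \<alpha> i * q i"
          using a by (intro mult_le_mono1) (simp add: adding_space_def Suc_leI)
        finally show ?case by (simp add: q_Suc)
      qed
      have s_mod: "s (Suc i) mod q i = s i" "s (Suc i) div q i = a i" for i
        using s_less[of i] by (simp_all add: s_def)
      have "(\<Inter>i. {x \<in> M. T i x = s i}) \<noteq> {}"
      proof (rule compact_space_imp_nest[OF Z T_closed])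
        show "{x \<in> M. T i x = s i} \<noteq> {}" for i using hit[OF s_less[of i]] by blast
        show "decseq (\<lambda>i. {x \<in> M. T i x = s i})"
        proof (rule decseq_SucI, rule subsetI)
          fix i x assume "x \<in> {x \<in> M. T (Suc i) x = s (Suc i)}"
          then show "x \<in> {x \<in> M. T i x = s i}"
            using T_mod[of x i] s_mod(1)[of i] by simp
        qed
      qed
      then obtain x where x: "x \<in> M" "\<And>i. T i x = s i" by auto
      have "\<phi> x = a" using x s_mod(2) by (simp add: \<phi>_def fun_eq_iff)
      then show "a \<in> \<phi> ` M" using x(1) by blast
    qed
  qed
  have conj: "\<phi> (g x) = adding_map \<alpha> (\<phi> x)" if x: "x \<in> M" for x
  proof -
    let ?u = "\<lambda>i::nat. if i = 0 then 1 else 0 :: nat"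
    \<comment> \<open>What is added to digit \<open>i\<close>: the unit in position 0 together with
      the incoming carry.\<close>
    define e where "e i = ?u i + adding_carry \<alpha> (\<phi> x) ?u i" for i
    have div: "Suc (T (Suc i) x) div q i = \<phi> x i + Suc (T i x) div q i" for i
      using T_Suc[OF x, of i] q_pos[of i] div_mult_self1[of "q i" "Suc (T i x)" "\<phi> x i"] by simp
    \<comment> \<open>For \<open>i > 0\<close> a carry arrives exactly when
      \<open>Suc (T i x)\<close> reaches \<open>q i\<close>; for \<open>i = 0\<close> the quotient
      by \<open>q 0 = 1\<close> is the unit itself.\<close>
    have e: "e i = Suc (T i x) div q i" for i
    proof (induction i)
      case 0 then show ?case by (simp add: e_def T0[OF x] q0)
    next
      case (Suc i)
      have "Suc (T (Suc i) x) div q (Suc i) = Suc (T (Suc i) x) div q i div \<alpha> i"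
        using div_mult2_eq[of "Suc (T (Suc i) x)" "q i" "\<alpha> i"] by (simp add: q_Suc mult.commute)
      also have "Suc (T (Suc i) x) div q i = \<phi> x i + e i"
        by (simp only: div Suc)
      finally have *: "Suc (T (Suc i) x) div q (Suc i) = (\<phi> x i + e i) div \<alpha> i" .
      have "e i \<le> 1"
        using T_less[OF x, of i] unfolding Suc by (metis Suc_leI div_le_mono div_self le_refl less_not_refl2 q_pos)
      then have "\<phi> x i + e i \<le> \<alpha> i" using \<phi>_less[OF x, of i] by simp
      then have "(\<phi> x i + e i) div \<alpha> i = (if \<phi> x i + e i < \<alpha> i then 0 else 1)"
        using \<alpha>_ge[of i] by auto
      moreover have "e (Suc i) = (if \<phi> x i + e i < \<alpha> i then 0 else 1)"
        by (simp add: e_def add.assoc)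
      ultimately show ?case using * by simp
    qed
    have "\<phi> (g x) i = (\<phi> x i + e i) mod \<alpha> i" for i
    proof -
      have "\<phi> (g x) i = Suc (T (Suc i) x) mod (q i * \<alpha> i) div q i"
        by (simp add: \<phi>_def T_step[OF x] q_Suc mult.commute)
      also have "\<dots> = Suc (T (Suc i) x) div q i mod \<alpha> i"
        using q_pos[of i] by (simp add: mod_mult2_eq)
      also have "Suc (T (Suc i) x) div q i = \<phi> x i + e i"
        by (simp only: div e)
      finally show ?thesis .
    qed
    then show ?thesis
      by (simp add: adding_map_def adding_plus_def e_def fun_eq_iff add.assoc)
  qed
  have "homeomorphic_map (subtopology Z M) (adding_topology \<alpha>) \<phi>"
  proof (rule continuous_imp_homeomorphic_map[OF cont])
    show "compact_space (subtopology Z M)"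
      using closedin_compact_space[OF Z] M(1) compact_space_subtopology
      by (auto simp: closed_invariant_def)
    show "Hausdorff_space (adding_topology \<alpha>)"
      by (simp add: adding_topology_def A.Hausdorff_space_mtopology)
    show "\<phi> ` topspace (subtopology Z M) = topspace (adding_topology \<alpha>)"
      using surj Msub by (simp add: adding_topology_def Int_absorb1)
    show "inj_on \<phi> (topspace (subtopology Z M))"
      using inj Msub by (simp add: Int_absorb1)
  qed
  then show ?thesis
    unfolding adding_machine_def topologically_conjugate_def
    using M(1) \<alpha>_ge conj by (intro conjI exI[of _ \<alpha>] exI[of _ \<phi>]) auto
qed

text \<open>Divisibility of the exponents makes the cyclic decompositions of \<open>M\<close> under
  the powers successively finer. The position of a point in each cycle gives the functions required
  by \<open>adding_machineI\<close>, and \<open>sep\<close> ensures that these positions determine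
  the point.\<close>

theorem minimal_set_adding_machine:
  assumes Z: "compact_space Z" "Hausdorff_space Z" "continuous_map Z Z g"
    and M: "minimal_set Z g M" "infinite M"
    and p: "p 0 = 1" "\<And>i. p i \<ge> 1" "\<And>i. p i dvd p (Suc i)"
    and sep: "\<And>x y. (\<And>i. \<exists>N. N \<subseteq> M \<and> minimal_set Z (g ^^ p i) N \<and> x \<in> N \<and> y \<in> N) \<Longrightarrow> x = y"
  shows "adding_machine Z g M"
proof -
  obtain c where c: "c \<in> M" using minimal_setD(1)[OF M(1)] by blast
  have inv: "(g ^^ t) ` N \<subseteq> M" if "N \<subseteq> M" for N t
  proof -
    have "(g ^^ t) ` M \<subseteq> M"
      using closed_invariant_funpow[OF minimal_setD(2)[OF M(1)], of t] by (simp add: closed_invariant_def)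
    then show ?thesis using that by (meson image_mono subset_trans)
  qed
  have "\<exists>N \<subseteq> M. minimal_set Z (g ^^ p i) N \<and> c \<in> N" for i
  proof -
    obtain N where N: "N \<subseteq> M" "minimal_set Z (g ^^ p i) N"
      using minimal_set_exists[OF Z(1) closed_invariant_funpow[OF minimal_setD(2)[OF M(1)]] minimal_setD(1)[OF M(1)]] .
    obtain q where "M = (\<Union>t<q. (g ^^ t) ` N)"
      using minimal_set_power_cycle[OF Z M(1) N(2,1) p(2)] by metis
    then obtain t where "c \<in> (g ^^ t) ` N" using c by blast
    then show ?thesis
      by (intro exI[of _ "(g ^^ t) ` N"] conjI inv[OF N(1)] minimal_set_funpow_image[OF Z N(2)])
  qed
  then obtain N where N: "\<And>i. N i \<subseteq> M" "\<And>i. minimal_set Z (g ^^ p i) (N i)" "\<And>i. c \<in> N i"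
    by metis
  \<comment> \<open>The piece \<open>N i\<close> is invariant under the later power, whose minimal
    set \<open>N (Suc i)\<close> meets it at \<open>c\<close>.\<close>
  have N_Suc: "N (Suc i) \<subseteq> N i" for i
  proof -
    obtain k where "p (Suc i) = p i * k" using p(3) by (auto simp: dvd_def)
    then have "closed_invariant Z (g ^^ p (Suc i)) (N i)"
      using closed_invariant_funpow[OF minimal_setD(2)[OF N(2)[of i]], of k] by (simp add: funpow_mult mult.commute)
    then show ?thesis
      using minimal_set_subset[OF N(2)] N(3) by blast
  qed
  then have N_anti: "N j \<subseteq> N i" if "i \<le> j" for i j
    using lift_Suc_antimono_le[of N] that by blast
  have "\<exists>q. q \<ge> 1 \<and> q dvd p i \<and> M = (\<Union>t<q. (g ^^ t) ` N i)
      \<and> (\<forall>s t. (g ^^ s) ` N i \<inter> (g ^^ t) ` N i \<noteq> {} \<longleftrightarrow> s mod q = t mod q)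
      \<and> (\<forall>s t. s mod q = t mod q \<longrightarrow> (g ^^ s) ` N i = (g ^^ t) ` N i)" for i
    by (rule minimal_set_power_cycle[OF Z M(1) N(2,1) p(2), of i]) (intro exI conjI allI impI; assumption?; simp)
  then obtain q where q: "\<And>i. q i \<ge> 1" "\<And>i. q i dvd p i"
    and cover: "\<And>i. M = (\<Union>t<q i. (g ^^ t) ` N i)"
    and meet: "\<And>i s t. (g ^^ s) ` N i \<inter> (g ^^ t) ` N i \<noteq> {} \<longleftrightarrow> s mod q i = t mod q i"
    and eq: "\<And>i s t. s mod q i = t mod q i \<Longrightarrow> (g ^^ s) ` N i = (g ^^ t) ` N i"
    by metis
  \<comment> \<open>After \<open>q (Suc i)\<close> steps the smaller piece, which contains
    \<open>c\<close>, is back at itself, so \<open>N i\<close> meets its own image at that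
    time.\<close>
  have q_dvd_Suc: "q i dvd q (Suc i)" for i
  proof -
    have "(g ^^ q (Suc i)) ` N (Suc i) = (g ^^ 0) ` N (Suc i)"
      by (rule eq) simp
    then have "c \<in> (g ^^ q (Suc i)) ` N i"
      using N(3)[of "Suc i"] N_Suc[of i] by auto
    then have "(g ^^ q (Suc i)) ` N i \<inter> (g ^^ 0) ` N i \<noteq> {}"
      using N(3)[of i] by auto
    then show ?thesis by (simp only: meet mod_0 mod_eq_0_iff_dvd)
  qed
  then have q_mono: "mono q"
    using q(1) by (intro mono_iff_le_Suc[THEN iffD2] allI dvd_imp_le) (auto simp: Suc_le_eq)
  have q_dvd: "q i dvd q j" if "i \<le> j" for i j
    using that by (induction rule: dec_induct) (use q_dvd_Suc dvd_trans in auto)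
  \<comment> \<open>If the periods stayed bounded, the pieces would stabilise and be singletons.\<close>
  have unbounded: "\<exists>j>i. q i < q j" for i
  proof (rule ccontr)
    assume "\<not> (\<exists>j>i. q i < q j)"
    then have const: "q j = q i" if "i \<le> j" for j
      using q_mono that by (metis le_antisym le_neq_implies_less monoD not_less)
    have same: "N j = N i" if ij: "i \<le> j" for j
    proof
      show "N j \<subseteq> N i" by (rule N_anti[OF ij])
      show "N i \<subseteq> N j"
      proof
        fix x assume x: "x \<in> N i"
        then obtain t where t: "t < q i" "x \<in> (g ^^ t) ` N j"
          using N(1)[of i] cover[of j] const[OF ij] by auto
        then have "x \<in> (g ^^ t) ` N i" using N_anti[OF ij] by blast
        then have "(g ^^ t) ` N i \<inter> (g ^^ 0) ` N i \<noteq> {}" using x by auto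
        then have "t = 0" using t(1) unfolding meet by simp
        then show "x \<in> N j" using t(2) by simp
      qed
    qed
    have "x = c" if "x \<in> N i" for x
    proof (rule sep)
      fix j
      show "\<exists>N. N \<subseteq> M \<and> minimal_set Z (g ^^ p j) N \<and> x \<in> N \<and> c \<in> N"
      proof (intro exI[of _ "N j"] conjI N)
        show "x \<in> N j"
          using that same[of j] N_anti[of j i] by (cases "i \<le> j") auto
      qed
    qed
    then have "finite (N i)"
      using finite_subset[of "N i" "{c}"] by blast
    then have "finite (\<Union>t<q i. (g ^^ t) ` N i)" by simp
    then show False using M(2) unfolding cover[of i, symmetric] by contradiction
  qed
  \<comment> \<open>A subsequence makes the periods strictly increasing, as
    \<open>adding_machineI\<close> requires; starting it at 0 keeps the first period equal to
    1.\<close>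
  have "\<exists>r. \<forall>i. (i = 0 \<longrightarrow> r i = 0) \<and> r i < r (Suc i) \<and> q (r i) < q (r (Suc i))"
  proof (rule dependent_nat_choice)
    show "\<exists>y. (Suc n = 0 \<longrightarrow> y = 0) \<and> x < y \<and> q x < q y" for x n
      using unbounded[of x] by simp
  qed simp
  then obtain r where r0: "\<forall>i. (i = 0 \<longrightarrow> r i = 0) \<and> r i < r (Suc i) \<and> q (r i) < q (r (Suc i))" ..
  then have r: "r 0 = 0" "\<And>i. r i < r (Suc i)" "\<And>i. q (r i) < q (r (Suc i))" by simp_all
  have r_ge: "i \<le> r i" for i
    using r(2) by (intro strict_mono_imp_increasing) (simp add: strict_mono_Suc_iff)
  define T where "T i x = (SOME t. t < q (r i) \<and> x \<in> (g ^^ t) ` N (r i))" for i x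
  have T: "T i x < q (r i) \<and> x \<in> (g ^^ T i x) ` N (r i)" if "x \<in> M" for i x
  proof -
    have "\<exists>t. t < q (r i) \<and> x \<in> (g ^^ t) ` N (r i)"
      using that cover[of "r i"] by blast
    then show ?thesis unfolding T_def by (rule someI_ex)
  qed
  have T_eq: "t mod q (r i) = T i x" if "x \<in> M" "x \<in> (g ^^ t) ` N (r i)" for i t x
  proof -
    have "(g ^^ t) ` N (r i) \<inter> (g ^^ T i x) ` N (r i) \<noteq> {}" using that T by blast
    then show ?thesis using T[OF that(1), of i] unfolding meet by simp
  qed
  show ?thesis
  proof (rule adding_machineI[OF Z(1) minimal_setD(2,1)[OF M(1)], of "\<lambda>i. q (r i)" T])
    show "q (r 0) = 1" using q(2)[of 0] by (simp add: r(1) p(1))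
    show "q (r i) dvd q (r (Suc i))" "q (r i) < q (r (Suc i))" for i
      using q_dvd[of "r i" "r (Suc i)"] r by (auto simp: less_imp_le)
    show "T i x < q (r i)" if "x \<in> M" for i x using T that by blast
    show "T i (g x) = Suc (T i x) mod q (r i)" if "x \<in> M" for i x
    proof -
      have "g x \<in> (g ^^ Suc (T i x)) ` N (r i)"
        using imageI[OF conjunct2[OF T[OF that, of i]], of g] by (simp add: image_comp)
      moreover have "g x \<in> M" using minimal_setD(4)[OF M(1)] that by blast
      ultimately show ?thesis using T_eq by metis
    qed
    show "T (Suc i) x mod q (r i) = T i x" if "x \<in> M" for i x
      using T[OF that, of "Suc i"] N_anti[OF less_imp_le[OF r(2)], of i] by (intro T_eq[OF that]) blast
    show "closedin Z {x \<in> M. T i x = t}" for i t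
    proof (cases "t < q (r i)")
      case True
      have "{x \<in> M. T i x = t} = (g ^^ t) ` N (r i)"
      proof (intro set_eqI iffI)
        fix x assume x: "x \<in> (g ^^ t) ` N (r i)"
        then have "x \<in> M" using inv[OF N(1)] by blast
        then show "x \<in> {x \<in> M. T i x = t}" using T_eq[OF _ x] True by simp
      qed (use T in blast)
      then show ?thesis using closedin_funpow_image[OF Z minimal_setD(3)[OF N(2)]] by simp
    next
      case False
      then have "{x \<in> M. T i x = t} = {}" using T by blast
      then show ?thesis by (simp only: closedin_empty)
    qed
    show "x = y" if xy: "x \<in> M" "y \<in> M" "\<And>i. T i x = T i y" for x y
    proof (rule sep)
      fix i
      have p_dvd: "p i dvd p (r i)"
        using r_ge[of i] by (induction rule: dec_induct) (use p(3) dvd_trans in auto)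
      \<comment> \<open>As \<open>i \<le> r i\<close>, equal positions at stage \<open>r i\<close>
        put both points in the same piece at stage \<open>i\<close>, the form that
        \<open>sep\<close> asks for.\<close>
      define t where "t = T i x"
      have "x \<in> (g ^^ t) ` N (r i)" "y \<in> (g ^^ t) ` N (r i)"
        using T[OF xy(1), of i] T[OF xy(2), of i] xy(3)[of i] by (simp_all add: t_def)
      then have "x \<in> (g ^^ t) ` N i" "y \<in> (g ^^ t) ` N i"
        using N_anti[OF r_ge[of i]] by blast+
      then show "\<exists>N. N \<subseteq> M \<and> minimal_set Z (g ^^ p i) N \<and> x \<in> N \<and> y \<in> N"
        using inv[OF N(1)] minimal_set_funpow_image[OF Z N(2)] by blast
    qed
  qed
qed

section \<open>The hyperspace carries the Vietoris topology\<close>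

locale hyperspace_compact = Metric_space X d for X :: "'a set" and d +
  assumes compact: "compact_space mtopology"
begin

abbreviation H where "H \<equiv> hyperspace X d"

sublocale H: Metric_space "hyperspace X d" "hausdorff_dist X d"
  by (rule Metric_space_hyperspace[OF Metric_space_axioms compact])

lemma hyperspaceD:
  assumes "A \<in> H"
  shows "A \<noteq> {}" "closedin mtopology A" "A \<subseteq> X"
  using assms closedin_subset[of mtopology A] by (auto simp: hyperspace_def)

lemma hyperspaceI: "A \<noteq> {} \<Longrightarrow> closedin mtopology A \<Longrightarrow> A \<in> H"
  by (simp add: hyperspace_def)

lemma bdd_above_infdist:
  assumes "A \<in> H" "B \<in> H"
  shows "bdd_above ((\<lambda>a. INF b\<in>B. d a b) ` A)"
proof -
  have "mbounded X"
    using compact compactin_imp_mbounded unfolding compact_space_def by simp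
  then obtain K where K: "\<And>x y. x \<in> X \<Longrightarrow> y \<in> X \<Longrightarrow> d x y \<le> K"
    unfolding mbounded_alt by blast
  obtain b where b: "b \<in> B" using hyperspaceD(1)[OF assms(2)] by blast
  show ?thesis
  proof (rule bdd_aboveI2)
    fix a assume a: "a \<in> A"
    have "(INF b\<in>B. d a b) \<le> d a b"
      by (rule cINF_lower[OF bdd_belowI[of _ 0] b]) auto
    also have "\<dots> \<le> K" using a b hyperspaceD(3)[OF assms(1)] hyperspaceD(3)[OF assms(2)] K by blast
    finally show "(INF b\<in>B. d a b) \<le> K" .
  qed
qed

lemma hausdorff_dist_le:
  assumes "A \<in> H" "B \<in> H"
    and "\<And>a. a \<in> A \<Longrightarrow> \<exists>b\<in>B. d a b \<le> e" "\<And>b. b \<in> B \<Longrightarrow> \<exists>a\<in>A. d a b \<le> e"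
  shows "hausdorff_dist X d A B \<le> e"
proof -
  have "(SUP a\<in>A. INF b\<in>B. d a b) \<le> e"
  proof (rule cSUP_least[OF hyperspaceD(1)[OF assms(1)]])
    fix a assume "a \<in> A"
    then obtain b where b: "b \<in> B" "d a b \<le> e" using assms(3) by blast
    have "(INF b\<in>B. d a b) \<le> d a b"
      by (rule cINF_lower[OF bdd_belowI[of _ 0] b(1)]) auto
    with b(2) show "(INF b\<in>B. d a b) \<le> e" by simp
  qed
  moreover have "(SUP b\<in>B. INF a\<in>A. d a b) \<le> e"
  proof (rule cSUP_least[OF hyperspaceD(1)[OF assms(2)]])
    fix b assume "b \<in> B"
    then obtain a where a: "a \<in> A" "d a b \<le> e" using assms(4) by blast
    have "(INF a\<in>A. d a b) \<le> d a b"
      by (rule cINF_lower[OF bdd_belowI[of _ 0] a(1)]) auto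
    with a(2) show "(INF a\<in>A. d a b) \<le> e" by simp
  qed
  ultimately show ?thesis using assms(1,2) by (simp add: hausdorff_dist_def)
qed

lemma hausdorff_dist_lessD:
  assumes "A \<in> H" "B \<in> H" "hausdorff_dist X d A B < e" "a \<in> A"
  shows "\<exists>b\<in>B. d a b < e"
proof -
  have "(INF b\<in>B. d a b) \<le> (SUP a\<in>A. INF b\<in>B. d a b)"
    by (rule cSUP_upper[OF assms(4) bdd_above_infdist[OF assms(1,2)]])
  also have "\<dots> < e" using assms(1-3) by (simp add: hausdorff_dist_def)
  finally show ?thesis
    by (subst (asm) cINF_less_iff[OF hyperspaceD(1)[OF assms(2)] bdd_belowI[of _ 0]]) auto
qed

lemma openin_hit:
  assumes U: "openin mtopology U"
  shows "openin H.mtopology {A \<in> H. A \<inter> U \<noteq> {}}"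
  unfolding H.openin_mtopology
proof (intro conjI allI impI)
  fix A assume "A \<in> {A \<in> H. A \<inter> U \<noteq> {}}"
  then obtain a where A: "A \<in> H" "a \<in> A" "a \<in> U" by blast
  then obtain r where r: "r > 0" "mball a r \<subseteq> U"
    using U unfolding openin_mtopology by blast
  have "H.mball A r \<subseteq> {A \<in> H. A \<inter> U \<noteq> {}}"
  proof
    fix B assume "B \<in> H.mball A r"
    then have B: "B \<in> H" "hausdorff_dist X d A B < r" by auto
    then obtain b where "b \<in> B" "d a b < r"
      using hausdorff_dist_lessD[OF A(1) B A(2)] by blast
    then have "b \<in> mball a r" using A B hyperspaceD(3) by auto
    then show "B \<in> {A \<in> H. A \<inter> U \<noteq> {}}" using r(2) \<open>b \<in> B\<close> B(1) by blast
  qed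
  then show "\<exists>r>0. H.mball A r \<subseteq> {A \<in> H. A \<inter> U \<noteq> {}}" using r(1) by blast
qed blast

text \<open>Compactness of \<open>A\<close> provides a single radius, a Lebesgue number of the cover
  \<open>{U}\<close>, whose balls around all points of \<open>A\<close> stay in
  \<open>U\<close>.\<close>

lemma openin_inside:
  assumes U: "openin mtopology U"
  shows "openin H.mtopology {A \<in> H. A \<subseteq> U}"
  unfolding H.openin_mtopology
proof (intro conjI allI impI)
  fix A assume "A \<in> {A \<in> H. A \<subseteq> U}"
  then have A: "A \<in> H" "A \<subseteq> U" by blast+
  have "compactin mtopology A"
    by (rule closedin_compact_space[OF compact hyperspaceD(2)[OF A(1)]])
  then obtain r where r: "r > 0" "\<And>x. x \<in> A \<Longrightarrow> mball x r \<subseteq> U"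
    using lebesgue_number[of A "{U}"] A U by auto
  have "H.mball A r \<subseteq> {A \<in> H. A \<subseteq> U}"
  proof
    fix B assume "B \<in> H.mball A r"
    then have B: "B \<in> H" "hausdorff_dist X d B A < r" by (auto simp: H.commute)
    have "b \<in> U" if b: "b \<in> B" for b
    proof -
      obtain a where a: "a \<in> A" "d b a < r"
        using hausdorff_dist_lessD[OF B(1) A(1) B(2) b] by blast
      then have "b \<in> mball a r"
        using b hyperspaceD(3)[OF A(1)] hyperspaceD(3)[OF B(1)] by (auto simp: commute)
      then show ?thesis using r(2)[OF a(1)] by blast
    qed
    then show "B \<in> {A \<in> H. A \<subseteq> U}" using B(1) by blast
  qed
  then show "\<exists>r>0. H.mball A r \<subseteq> {A \<in> H. A \<subseteq> U}" using r(1) by blast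
qed blast

section \<open>The Vietoris topology and its compactness\<close>

definition vietoris_subbase :: "'a set set set" where
  "vietoris_subbase = {{A \<in> H. A \<inter> U \<noteq> {}} | U. openin mtopology U} \<union> {{A \<in> H. A \<subseteq> U} | U. openin mtopology U}"

text \<open>Written in the explicit subbase form used by \<open>Alexander_subbase\<close> and
  \<open>continuous_map_into_topology_subbase_eq\<close>.\<close>

definition vietoris :: "'a set topology" where
  "vietoris = topology (arbitrary union_of (finite intersection_of (\<lambda>S. S \<in> vietoris_subbase) relative_to \<Union>vietoris_subbase))"

lemma Union_vietoris_subbase: "\<Union>vietoris_subbase = H"
proof
  show "\<Union>vietoris_subbase \<subseteq> H" by (auto simp: vietoris_subbase_def)
  have "{A \<in> H. A \<subseteq> X} \<in> vietoris_subbase"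
    using openin_topspace[of mtopology] by (auto simp: vietoris_subbase_def)
  then show "H \<subseteq> \<Union>vietoris_subbase" using hyperspaceD(3) by blast
qed

lemma topspace_vietoris: "topspace vietoris = H"
  unfolding vietoris_def topspace_subbase by (rule Union_vietoris_subbase)

lemma openin_vietoris_subbase:
  assumes "S \<in> vietoris_subbase"
  shows "openin vietoris S"
  unfolding vietoris_def
proof (rule openin_subbase[THEN iffD2])
  have "(finite intersection_of (\<lambda>S. S \<in> vietoris_subbase) relative_to \<Union>vietoris_subbase) S"
    using assms by (intro relative_to_subset_inc finite_intersection_of_inc) auto
  then show "(arbitrary union_of (finite intersection_of (\<lambda>S. S \<in> vietoris_subbase) relative_to \<Union>vietoris_subbase)) S"
    by (rule arbitrary_union_of_inc)
qed

text \<open>Let \<open>\<U>\<close> be the open sets whose hit sets occur in the cover. The closed set \<open>X - \<Union>\<U>\<close>, if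
  nonempty, must be covered by some \<open>{A. A \<subseteq> V}\<close>; then \<open>V\<close> and finitely many members of \<open>\<U>\<close> cover \<open>X\<close>.\<close>

lemma compact_space_vietoris: "compact_space vietoris"
proof (rule Alexander_subbase[OF vietoris_def[symmetric]])
  fix \<C> assume \<C>: "\<C> \<subseteq> vietoris_subbase" "\<Union>\<C> = topspace vietoris"
  define hit where "hit U = {A \<in> H. A \<inter> U \<noteq> {}}" for U
  define ins where "ins U = {A \<in> H. A \<subseteq> U}" for U
  define \<U> where "\<U> = {U. openin mtopology U \<and> hit U \<in> \<C>}"
  have compactX: "\<exists>\<F>. finite \<F> \<and> \<F> \<subseteq> \<U> \<and> X \<subseteq> V \<union> \<Union>\<F>"
    if "openin mtopology V" "X \<subseteq> V \<union> \<Union>\<U>" for V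
  proof -
    have "\<exists>\<F>. finite \<F> \<and> \<F> \<subseteq> insert V \<U> \<and> X \<subseteq> \<Union>\<F>"
      using compact that unfolding compact_space_alt by (auto simp: \<U>_def)
    then obtain \<F> where "finite \<F>" "\<F> \<subseteq> insert V \<U>" "X \<subseteq> \<Union>\<F>" by blast
    then show ?thesis by (intro exI[of _ "\<F> - {V}"]) auto
  qed
  have hit_all: "A \<in> \<Union>(hit ` \<F>)" if "A \<in> H" "\<not> A \<subseteq> V" "X \<subseteq> V \<union> \<Union>\<F>" for A V \<F>
    using that hyperspaceD(3)[OF that(1)] by (fastforce simp: hit_def)
  show "\<exists>\<C>'. finite \<C>' \<and> \<C>' \<subseteq> \<C> \<and> \<Union>\<C>' = topspace vietoris"
  proof (cases "X \<subseteq> \<Union>\<U>")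
    case True
    then obtain \<F> where \<F>: "finite \<F>" "\<F> \<subseteq> \<U>" "X \<subseteq> \<Union>\<F>"
      using compactX[of "{}"] by auto
    have "\<Union>(hit ` \<F>) = H"
      using hit_all[of _ "{}" \<F>] \<F>(3) hyperspaceD(1) by (auto simp: hit_def)
    then show ?thesis
      using \<F> by (intro exI[of _ "hit ` \<F>"]) (auto simp: \<U>_def topspace_vietoris)
  next
    case False
    have "closedin mtopology (X - \<Union>\<U>)"
      using openin_Union[of \<U> mtopology] by (intro closedin_diff) (auto simp: \<U>_def)
    then have K: "X - \<Union>\<U> \<in> H" using False by (intro hyperspaceI) auto
    then obtain S where S: "S \<in> \<C>" "X - \<Union>\<U> \<in> S"
      using \<C>(2) topspace_vietoris by blast
    obtain V where V: "openin mtopology V" "S = hit V \<or> S = ins V"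
      using S(1) \<C>(1) by (auto simp: vietoris_subbase_def hit_def ins_def)
    \<comment> \<open>The set \<open>X - \<Union>\<U>\<close> misses every member of
      \<open>\<U>\<close>, so it lies in no hit set of the cover.\<close>
    have "S \<noteq> hit V"
    proof
      assume "S = hit V"
      then have "V \<in> \<U>" using S V by (simp add: \<U>_def)
      then show False using S(2) \<open>S = hit V\<close> by (auto simp: hit_def)
    qed
    then have S_ins: "S = ins V" using V by blast
    then have "X \<subseteq> V \<union> \<Union>\<U>" using S(2) by (auto simp: ins_def)
    then obtain \<F> where \<F>: "finite \<F>" "\<F> \<subseteq> \<U>" "X \<subseteq> V \<union> \<Union>\<F>"
      using compactX[OF V(1)] by blast
    have "\<Union>(insert S (hit ` \<F>)) = H"
      using hit_all[of _ V \<F>] \<F>(3) unfolding S_ins by (auto simp: hit_def ins_def)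
    then show ?thesis
      using \<F> S(1) by (intro exI[of _ "insert S (hit ` \<F>)"]) (auto simp: \<U>_def topspace_vietoris)
  qed
qed

text \<open>A Hausdorff ball around \<open>A\<close> contains a Vietoris neighbourhood given by a finite cover
  of \<open>A\<close> by small balls.\<close>

lemma mtopology_hyperspace: "H.mtopology = vietoris"
  unfolding topology_eq
proof (intro allI iffI)
  fix S assume "openin vietoris S"
  then show "openin H.mtopology S"
    unfolding vietoris_def
  proof (rule minimal_topology_subbase[rotated 2])
    show "openin H.mtopology T" if "T \<in> vietoris_subbase" for T
      using that openin_hit openin_inside by (auto simp: vietoris_subbase_def)
    show "openin H.mtopology (\<Union>vietoris_subbase)"
      unfolding Union_vietoris_subbase using openin_topspace[of H.mtopology] by simp
  qed
next
  fix S assume S: "openin H.mtopology S"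
  show "openin vietoris S"
  proof (subst openin_subopen, intro ballI)
    fix A assume "A \<in> S"
    then obtain e where A: "A \<in> H" and e: "e > 0" "H.mball A e \<subseteq> S"
      using S unfolding H.openin_mtopology by blast
    have "compactin mtopology A"
      by (rule closedin_compact_space[OF compact hyperspaceD(2)[OF A]])
    moreover have "A \<subseteq> \<Union>((\<lambda>a. mball a (e/4)) ` A)"
      using hyperspaceD(3)[OF A] e(1) by auto
    ultimately obtain F where F: "finite F" "F \<subseteq> A" "A \<subseteq> (\<Union>a\<in>F. mball a (e/4))"
      by (smt (verit, ccfv_threshold) compactinD finite_subset_image imageE openin_mball)
    \<comment> \<open>Two points in one ball of radius \<open>e/4\<close> are less than
      \<open>e/2\<close> apart; the non-strict bound \<open>e/2\<close> obtained from
      \<open>hausdorff_dist_le\<close> still lies below \<open>e\<close>.\<close>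
    define W where "W = (\<Inter>a\<in>F. {B \<in> H. B \<inter> mball a (e/4) \<noteq> {}}) \<inter> {B \<in> H. B \<subseteq> (\<Union>a\<in>F. mball a (e/4))}"
    have F_ne: "F \<noteq> {}" using F(3) hyperspaceD(1)[OF A] by auto
    have "openin vietoris (\<Inter>a\<in>F. {B \<in> H. B \<inter> mball a (e/4) \<noteq> {}})"
    proof (rule openin_Inter)
      fix T assume "T \<in> (\<lambda>a. {B \<in> H. B \<inter> mball a (e/4) \<noteq> {}}) ` F"
      then obtain a where "T = {B \<in> H. B \<inter> mball a (e/4) \<noteq> {}}" by blast
      then show "openin vietoris T"
        unfolding vietoris_subbase_def by (intro openin_vietoris_subbase) (auto simp: vietoris_subbase_def)
    qed (use F F_ne in auto)
    moreover have "openin vietoris {B \<in> H. B \<subseteq> (\<Union>a\<in>F. mball a (e/4))}"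
    proof (rule openin_vietoris_subbase)
      have "openin mtopology (\<Union>a\<in>F. mball a (e/4))" by (intro openin_Union) auto
      then show "{B \<in> H. B \<subseteq> (\<Union>a\<in>F. mball a (e/4))} \<in> vietoris_subbase"
        unfolding vietoris_subbase_def by blast
    qed
    ultimately have "openin vietoris W" unfolding W_def by (rule openin_Int)
    moreover have "A \<in> W"
    proof -
      have "a \<in> A \<inter> mball a (e/4)" if "a \<in> F" for a
        using that F(2) hyperspaceD(3)[OF A] e(1) by auto
      then show ?thesis using A F(3) unfolding W_def by blast
    qed
    moreover have "W \<subseteq> S"
    proof
      fix B assume B: "B \<in> W"
      then have BH: "B \<in> H" and Bcov: "B \<subseteq> (\<Union>a\<in>F. mball a (e/4))"
        and Bhit: "\<And>a. a \<in> F \<Longrightarrow> B \<inter> mball a (e/4) \<noteq> {}"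
        by (auto simp: W_def)
      have "hausdorff_dist X d A B \<le> e/2"
      proof (rule hausdorff_dist_le[OF A BH])
        fix a assume a: "a \<in> A"
        then obtain c where c: "c \<in> F" "a \<in> mball c (e/4)" using F(3) by blast
        then obtain b where b: "b \<in> B" "b \<in> mball c (e/4)" using Bhit by blast
        have "d a b \<le> d a c + d c b" using b c by (intro triangle) auto
        also have "\<dots> \<le> e/2" using b c by (simp add: commute[of a c])
        finally show "\<exists>b\<in>B. d a b \<le> e/2" using b(1) by blast
      next
        fix b assume b: "b \<in> B"
        then obtain a where a: "a \<in> F" "b \<in> mball a (e/4)" using Bcov by blast
        then have "d a b \<le> e/2" using e(1) by simp
        then show "\<exists>a\<in>A. d a b \<le> e/2" using a(1) F(2) by blast
      qed
      then have "B \<in> H.mball A e" using A BH e(1) by simp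
      then show "B \<in> S" using e(2) by blast
    qed
    ultimately show "\<exists>T. openin vietoris T \<and> A \<in> T \<and> T \<subseteq> S" by blast
  qed
qed

lemma compact_space_hyperspace: "compact_space H.mtopology"
  by (simp add: mtopology_hyperspace compact_space_vietoris)

text \<open>The complement consists of the members of \<open>H\<close> inside the open set
  \<open>X - {x}\<close>.\<close>

lemma closedin_containing:
  assumes "x \<in> X"
  shows "closedin H.mtopology {A \<in> H. x \<in> A}"
proof -
  have "openin H.mtopology {A \<in> H. A \<subseteq> X - {x}}"
    using assms openin_topspace[of mtopology]
    by (intro openin_inside openin_diff) (simp_all add: closedin_Hausdorff_sing_eq[OF Hausdorff_space_mtopology])
  moreover have "H - {A \<in> H. x \<in> A} = {A \<in> H. A \<subseteq> X - {x}}"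
    using hyperspaceD(3) by blast
  ultimately show ?thesis by (auto simp: closedin_def)
qed

text \<open>The preimages of the hit and inclusion sets of \<open>U\<close> are the hit and
  inclusion sets of the preimage of \<open>U\<close>, so continuity is checked on the
  subbase.\<close>

lemma continuous_map_induced_map:
  assumes "continuous_map mtopology mtopology f"
  shows "continuous_map H.mtopology H.mtopology (induced_map f)"
proof -
  have fX: "f ` X \<subseteq> X" using assms by (auto simp: continuous_map_def)
  have fH: "f ` A \<in> H" if "A \<in> H" for A
  proof (rule hyperspaceI)
    show "closedin mtopology (f ` A)"
      by (rule compactin_imp_closedin[OF Hausdorff_space_mtopology
            image_compactin[OF closedin_compact_space[OF compact hyperspaceD(2)[OF that]] assms]])
  qed (use hyperspaceD(1)[OF that] in blast)
  have pre: "openin mtopology {x \<in> X. f x \<in> U}" if "openin mtopology U" for U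
    using openin_continuous_map_preimage[OF assms that] by simp
  have "openin H.mtopology {A \<in> H. induced_map f A \<in> S}" if S: "S \<in> vietoris_subbase" for S
  proof -
    obtain U where U: "openin mtopology U" "S = {A \<in> H. A \<inter> U \<noteq> {}} \<or> S = {A \<in> H. A \<subseteq> U}"
      using S unfolding vietoris_subbase_def by blast
    have "{A \<in> H. induced_map f A \<in> {A \<in> H. A \<inter> U \<noteq> {}}} = {A \<in> H. A \<inter> {x \<in> X. f x \<in> U} \<noteq> {}}"
      using fH hyperspaceD(3) by (fastforce simp: induced_map_def)
    moreover have "{A \<in> H. induced_map f A \<in> {A \<in> H. A \<subseteq> U}} = {A \<in> H. A \<subseteq> {x \<in> X. f x \<in> U}}"
      using fH hyperspaceD(3) by (fastforce simp: induced_map_def)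
    ultimately show ?thesis
      using U openin_hit[OF pre[OF U(1)]] openin_inside[OF pre[OF U(1)]] by (elim disjE) simp_all
  qed
  moreover have "induced_map f \<in> H \<rightarrow> H" using fH by (auto simp: induced_map_def)
  ultimately have "continuous_map H.mtopology vietoris (induced_map f)"
    by (subst continuous_map_into_topology_subbase_eq[OF vietoris_def]) (simp add: topspace_vietoris)
  then show ?thesis by (simp add: mtopology_hyperspace)
qed

end

section \<open>Omega limits\<close>

text \<open>Pigeonhole on residues. It selects times along which periodic points or sets behave as
  under one fixed iterate.\<close>

lemma frequent_residue:
  fixes r :: "nat \<Rightarrow> nat"
  assumes "infinite K" "N \<ge> 1"
  obtains \<rho> where "\<rho> < N" "infinite {k \<in> K. r k mod N = \<rho>}"
proof -
  have "finite ((\<lambda>k. r k mod N) ` K)"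
    by (rule finite_subset[of _ "{..<N}"]) (use assms(2) in auto)
  from pigeonhole_infinite[OF assms(1) this] obtain k0
    where "k0 \<in> K" "infinite {k \<in> K. r k mod N = r k0 mod N}" by blast
  then show ?thesis using that[of "r k0 mod N"] assms(2) by simp
qed

context Metric_space
begin

lemma sublimit:
  assumes "compact_space mtopology" "range \<sigma> \<subseteq> M"
  obtains l r where "l \<in> M" "strict_mono (r :: nat \<Rightarrow> nat)" "limitin mtopology (\<sigma> \<circ> r) l sequentially"
  using assms unfolding compact_space_def topspace_mtopology compactin_sequentially by metis

text \<open>The condition \<open>k \<le> r k\<close> expresses that the times tend to infinity and
  asks for no monotonicity.\<close>

lemma omega_limitI:
  assumes "limitin mtopology (\<lambda>k. (g ^^ r k) z) y sequentially" "\<And>k. k \<le> r k"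
  shows "y \<in> omega_limit mtopology g z"
  unfolding omega_limit_def metric_closure_of
proof (intro INT_I CollectI conjI allI impI)
  show "y \<in> M" using limitin_mspace[OF assms(1)] .
  fix n and e :: real assume "e > 0"
  then have "eventually (\<lambda>k. (g ^^ r k) z \<in> M \<and> d ((g ^^ r k) z) y < e) sequentially"
    using assms(1) unfolding limitin_metric by blast
  then obtain m where m: "\<And>k. k \<ge> m \<Longrightarrow> (g ^^ r k) z \<in> M \<and> d ((g ^^ r k) z) y < e"
    unfolding eventually_sequentially by blast
  let ?k = "max m n"
  have "(g ^^ r ?k) z \<in> mball y e"
    using m[of ?k] \<open>y \<in> M\<close> by (simp add: commute)
  moreover have "n \<le> r ?k" using assms(2)[of ?k] by simp
  ultimately show "\<exists>x\<in>{(g ^^ k) z |k. n \<le> k}. x \<in> mball y e" by blast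
qed

lemma omega_limitE:
  assumes "y \<in> omega_limit mtopology g z"
  obtains r where "\<And>k. k \<le> r k" "limitin mtopology (\<lambda>k. (g ^^ r k) z) y sequentially"
proof -
  have cl: "y \<in> M" "\<And>n e. e > 0 \<Longrightarrow> \<exists>k\<ge>n. (g ^^ k) z \<in> mball y e"
    using assms unfolding omega_limit_def metric_closure_of by blast+
  have "\<forall>n. \<exists>k\<ge>n. (g ^^ k) z \<in> mball y (inverse (Suc n))"
    using cl(2) by simp
  then obtain r where r: "\<And>n. n \<le> r n" "\<And>n. (g ^^ r n) z \<in> mball y (inverse (Suc n))"
    by metis
  have "limitin mtopology (\<lambda>k. (g ^^ r k) z) y sequentially"
    unfolding limitin_metric
  proof (intro conjI allI impI)
    fix e :: real assume "e > 0"
    then have "eventually (\<lambda>n. inverse (real (Suc n)) < e) sequentially"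
      using LIMSEQ_inverse_real_of_nat order_tendstoD(2) by blast
    then show "eventually (\<lambda>k. (g ^^ r k) z \<in> M \<and> d ((g ^^ r k) z) y < e) sequentially"
    proof eventually_elim
      case (elim n)
      then show ?case using r(2)[of n] by (simp add: commute)
    qed
  qed (rule cl(1))
  then show ?thesis using that r(1) by blast
qed

lemma closed_invariant_omega_limit:
  assumes "continuous_map mtopology mtopology g"
  shows "closed_invariant mtopology g (omega_limit mtopology g z)"
  unfolding closed_invariant_def
proof
  show "closedin mtopology (omega_limit mtopology g z)"
    unfolding omega_limit_def by (intro closedin_Inter) auto
  show "g ` omega_limit mtopology g z \<subseteq> omega_limit mtopology g z"
  proof
    fix x assume "x \<in> g ` omega_limit mtopology g z"
    then obtain y where y: "x = g y" "y \<in> omega_limit mtopology g z" by blast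
    obtain r where r: "\<And>k. k \<le> r k" "limitin mtopology (\<lambda>k. (g ^^ r k) z) y sequentially"
      using omega_limitE[OF y(2)] by metis
    have "limitin mtopology (\<lambda>k. (g ^^ Suc (r k)) z) x sequentially"
      using continuous_map_limit[OF assms r(2)] by (simp add: o_def y(1))
    then show "x \<in> omega_limit mtopology g z"
      by (rule omega_limitI) (simp add: r(1) le_SucI)
  qed
qed

lemma omega_limit_subset:
  assumes "closed_invariant mtopology g N" "z \<in> N"
  shows "omega_limit mtopology g z \<subseteq> N"
proof -
  have "(g ^^ k) z \<in> N" for k
    using closed_invariant_funpow[OF assms(1), of k] assms(2) by (auto simp: closed_invariant_def)
  then have "mtopology closure_of {(g ^^ k) z |k. k \<ge> 0} \<subseteq> N"
    using assms(1) by (intro closure_of_minimal) (auto simp: closed_invariant_def)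
  then show ?thesis unfolding omega_limit_def by blast
qed

text \<open>Compactness extracts the subsequence. Suitably chosen times produce elements of an
  omega-limit set with prescribed properties; with \<open>r\<close> the identity the set is seen to
  be nonempty.\<close>

lemma omega_limit_sublimit:
  assumes "compact_space mtopology" "closed_invariant mtopology g N" "z \<in> N" "\<And>k. k \<le> r k"
  obtains s y where "strict_mono s" "y \<in> omega_limit mtopology g z"
    "limitin mtopology (\<lambda>k. (g ^^ r (s k)) z) y sequentially"
proof -
  have "N \<subseteq> M" using assms(2) closedin_subset by (fastforce simp: closed_invariant_def)
  then have "(g ^^ k) z \<in> M" for k
    using closed_invariant_funpow[OF assms(2), of k] assms(3) by (auto simp: closed_invariant_def)
  then obtain y s where s: "strict_mono (s :: nat \<Rightarrow> nat)"
    "limitin mtopology ((\<lambda>k. (g ^^ r k) z) \<circ> s) y sequentially"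
    using sublimit[OF assms(1), of "\<lambda>k. (g ^^ r k) z"] by blast
  then have lim: "limitin mtopology (\<lambda>k. (g ^^ r (s k)) z) y sequentially"
    by (simp add: o_def)
  have "k \<le> r (s k)" for k
    using assms(4)[of "s k"] strict_mono_imp_increasing[OF s(1), of k] by linarith
  then have "y \<in> omega_limit mtopology g z" by (rule omega_limitI[OF lim])
  then show ?thesis using that s(1) lim by blast
qed

end

section \<open>Inclusions and limits in the hyperspace\<close>

context hyperspace_compact
begin

text \<open>Meeting the complement of \<open>D\<close> is an open condition; if \<open>A\<close> met
  it, almost all \<open>\<sigma> k\<close> would. Infinitely many inclusions therefore
  suffice.\<close>

lemma limit_subset:
  assumes lim: "limitin H.mtopology \<sigma> A sequentially" and D: "closedin mtopology D"
    and inf: "infinite {k. \<sigma> k \<subseteq> D}"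
  shows "A \<subseteq> D"
proof (rule ccontr)
  have A: "A \<in> H" using H.limitin_mspace[OF lim] .
  assume "\<not> A \<subseteq> D"
  then have "A \<in> {E \<in> H. E \<inter> (X - D) \<noteq> {}}" using A hyperspaceD(3)[OF A] by blast
  moreover have "openin H.mtopology {E \<in> H. E \<inter> (X - D) \<noteq> {}}"
    using D by (intro openin_hit) (auto simp: closedin_def)
  ultimately have "eventually (\<lambda>k. \<sigma> k \<in> {E \<in> H. E \<inter> (X - D) \<noteq> {}}) sequentially"
    using lim unfolding limitin_def by blast
  then have "eventually (\<lambda>k. \<not> \<sigma> k \<subseteq> D) sequentially"
    by (rule eventually_mono) blast
  then have "finite {k. \<sigma> k \<subseteq> D}"
    by (simp add: eventually_cofinite flip: cofinite_eq_sequentially)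
  then show False using inf by contradiction
qed

text \<open>Omitting \<open>x\<close> is an open condition by \<open>closedin_containing\<close>; if
  the limit omitted \<open>x\<close>, almost all \<open>\<sigma> k\<close> would.\<close>

lemma limit_contains:
  assumes lim: "limitin H.mtopology \<sigma> A sequentially" and x: "x \<in> X"
    and inf: "infinite {k. x \<in> \<sigma> k}"
  shows "x \<in> A"
proof (rule ccontr)
  have A: "A \<in> H" using H.limitin_mspace[OF lim] .
  assume "x \<notin> A"
  then have "A \<in> H - {E \<in> H. x \<in> E}" using A by blast
  moreover have "openin H.mtopology (H - {E \<in> H. x \<in> E})"
    using closedin_containing[OF x] by (simp add: closedin_def)
  ultimately have "eventually (\<lambda>k. \<sigma> k \<in> H - {E \<in> H. x \<in> E}) sequentially"
    using lim unfolding limitin_def by blast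
  then have "eventually (\<lambda>k. x \<notin> \<sigma> k) sequentially"
    by (rule eventually_mono) blast
  then have "finite {k. x \<in> \<sigma> k}"
    by (simp add: eventually_cofinite flip: cofinite_eq_sequentially)
  then show False using inf by contradiction
qed

text \<open>A point of \<open>A\<close> is near a point of \<open>\<sigma> k\<close>, which lies in
  \<open>\<tau> k\<close> and is near a point of \<open>B\<close>; as \<open>B\<close> is closed, it
  contains the original point.\<close>

lemma limit_mono:
  assumes limA: "limitin H.mtopology \<sigma> A sequentially" and limB: "limitin H.mtopology \<tau> B sequentially"
    and sub: "\<And>k. \<sigma> k \<subseteq> \<tau> k"
  shows "A \<subseteq> B"
proof
  have A: "A \<in> H" and B: "B \<in> H" using H.limitin_mspace limA limB by blast+
  fix a assume a: "a \<in> A"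
  have "\<exists>b\<in>B. b \<in> mball a e" if e: "e > 0" for e
  proof -
    have "eventually (\<lambda>k. \<sigma> k \<in> H \<and> hausdorff_dist X d (\<sigma> k) A < e/2) sequentially"
      using limA half_gt_zero[OF e] unfolding H.limitin_metric by blast
    moreover have "eventually (\<lambda>k. \<tau> k \<in> H \<and> hausdorff_dist X d (\<tau> k) B < e/2) sequentially"
      using limB half_gt_zero[OF e] unfolding H.limitin_metric by blast
    ultimately have "eventually (\<lambda>k. (\<sigma> k \<in> H \<and> hausdorff_dist X d (\<sigma> k) A < e/2) \<and>
        (\<tau> k \<in> H \<and> hausdorff_dist X d (\<tau> k) B < e/2)) sequentially"
      by (rule eventually_conj)
    from eventually_happens'[OF sequentially_bot this] obtain k
      where "\<sigma> k \<in> H \<and> hausdorff_dist X d (\<sigma> k) A < e/2"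
        "\<tau> k \<in> H \<and> hausdorff_dist X d (\<tau> k) B < e/2" by blast
    then have k: "\<sigma> k \<in> H" "hausdorff_dist X d A (\<sigma> k) < e/2"
      "\<tau> k \<in> H" "hausdorff_dist X d (\<tau> k) B < e/2"
      by (simp_all add: H.commute)
    obtain c where c: "c \<in> \<sigma> k" "d a c < e/2"
      using hausdorff_dist_lessD[OF A k(1,2) a] by blast
    obtain b where b: "b \<in> B" "d c b < e/2"
      using hausdorff_dist_lessD[OF k(3) B k(4)] c(1) sub by blast
    have X: "a \<in> X" "b \<in> X" "c \<in> X"
      using a b c hyperspaceD(3)[OF A] hyperspaceD(3)[OF B] hyperspaceD(3)[OF k(1)] by blast+
    then have "d a b < e" using triangle[of a c b] b(2) c(2) by linarith
    then show ?thesis using b(1) X by auto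
  qed
  then have "a \<in> mtopology closure_of B"
    using a hyperspaceD(3)[OF A] unfolding metric_closure_of by blast
  then show "a \<in> B" using closure_of_closedin[OF hyperspaceD(2)[OF B]] by simp
qed

text \<open>Zorn's lemma: for \<open>C\<close> in a chain, the members of \<open>\<M>\<close> above
  \<open>C\<close> form a closed set, cut out by the closed conditions \<open>x \<in> E\<close>.
  These sets form a chain too, and a common element is an upper bound.\<close>

lemma closed_set_maximal_element:
  assumes "closedin H.mtopology \<M>" "\<M> \<noteq> {}"
  shows "\<exists>C\<in>\<M>. \<forall>E\<in>\<M>. C \<subseteq> E \<longrightarrow> E = C"
proof (rule subset_Zorn)
  fix \<C> assume ch: "subset.chain \<M> \<C>"
  have \<C>: "\<C> \<subseteq> \<M>" using ch by (simp add: subset.chain_def)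
  have MH: "\<M> \<subseteq> H" using closedin_subset[OF assms(1)] by simp
  define above where "above C = {E \<in> \<M>. C \<subseteq> E}" for C
  show "\<exists>U\<in>\<M>. \<forall>C\<in>\<C>. C \<subseteq> U"
  proof (cases "\<C> = {}")
    case False
    have "\<Inter>(above ` \<C>) \<noteq> {}"
    proof (rule compact_space_chain_Inter[OF compact_space_hyperspace])
      fix S assume "S \<in> above ` \<C>"
      then obtain C where C: "C \<in> \<C>" "S = above C" by blast
      then have CM: "C \<in> \<M>" "C \<in> H" using \<C> MH by blast+
      have "closedin H.mtopology (\<Inter>x\<in>C. {E \<in> H. x \<in> E})"
      proof (rule closedin_Inter)
        fix T assume "T \<in> (\<lambda>x. {E \<in> H. x \<in> E}) ` C"
        then obtain x where x: "x \<in> C" "T = {E \<in> H. x \<in> E}" by blast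
        then have "x \<in> X" using hyperspaceD(3)[OF CM(2)] by blast
        then show "closedin H.mtopology T" unfolding x(2) by (rule closedin_containing)
      qed (use hyperspaceD(1)[OF CM(2)] in simp)
      then have cl: "closedin H.mtopology (\<M> \<inter> (\<Inter>x\<in>C. {E \<in> H. x \<in> E}))"
        by (rule closedin_Int[OF assms(1)])
      have "S = \<M> \<inter> (\<Inter>x\<in>C. {E \<in> H. x \<in> E})"
      proof (intro set_eqI iffI)
        fix E assume "E \<in> S"
        then have "E \<in> \<M>" "C \<subseteq> E" by (simp_all add: C(2) above_def)
        then show "E \<in> \<M> \<inter> (\<Inter>x\<in>C. {E \<in> H. x \<in> E})"
          using subsetD[OF MH] by simp blast
      next
        fix E assume "E \<in> \<M> \<inter> (\<Inter>x\<in>C. {E \<in> H. x \<in> E})"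
        then have "E \<in> \<M>" "\<And>x. x \<in> C \<Longrightarrow> x \<in> E" by simp_all
        then show "E \<in> S" by (simp add: C(2) above_def subsetI)
      qed
      moreover have "C \<in> S" using CM(1) by (simp add: C(2) above_def)
      ultimately show "closedin H.mtopology S \<and> S \<noteq> {}" using cl by (metis empty_iff)
    next
      fix S T assume "S \<in> above ` \<C>" "T \<in> above ` \<C>"
      then obtain C D where CD: "C \<in> \<C>" "D \<in> \<C>" "S = above C" "T = above D" by auto
      then have "C \<subseteq> D \<or> D \<subseteq> C" using ch unfolding subset.chain_def by blast
      then show "S \<subseteq> T \<or> T \<subseteq> S"
      proof
        assume "C \<subseteq> D" then show ?thesis by (auto simp: CD(3,4) above_def)
      next
        assume "D \<subseteq> C" then show ?thesis by (auto simp: CD(3,4) above_def)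
      qed
    qed
    then obtain U where "U \<in> \<Inter>(above ` \<C>)" by (metis ex_in_conv)
    then have U: "U \<in> above C" if "C \<in> \<C>" for C using that by (rule INT_D)
    obtain C0 where "C0 \<in> \<C>" using False by blast
    then have "U \<in> \<M>" using U by (simp add: above_def)
    then show ?thesis using U by (intro bexI[of _ U]) (simp_all add: above_def)
  qed (simp add: assms(2) ex_in_conv)
qed

end

section \<open>Pointwise periodic homeomorphisms\<close>

locale pointwise_periodic_system = hyperspace_compact X d for X :: "'a set" and d +
  fixes f :: "'a \<Rightarrow> 'a"
  assumes homeo: "homeomorphic_map mtopology mtopology f"
    and periodic: "pointwise_periodic_on X f"
begin

abbreviation F where "F \<equiv> induced_map f"

lemma funpow_induced_map: "(F ^^ k) A = (f ^^ k) ` A"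
  by (induction k) (auto simp: induced_map_def)

lemma homeomorphic_map_f_funpow: "homeomorphic_map mtopology mtopology (f ^^ k)"
  using homeo by (induction k) (auto intro: homeomorphic_map_compose simp: homeomorphic_map_id)

lemma continuous_f_funpow: "continuous_map mtopology mtopology (f ^^ k)"
  using homeomorphic_map_f_funpow by (rule homeomorphic_imp_continuous_map)

lemma f_funpow_in: "x \<in> X \<Longrightarrow> (f ^^ k) x \<in> X"
  using continuous_f_funpow[of k] by (auto simp: continuous_map_def)

lemma inj_f_funpow: "inj_on (f ^^ k) X"
  using homeomorphic_imp_injective_map[OF homeomorphic_map_f_funpow[of k]] by simp

lemma f_funpow_inject: "x \<in> X \<Longrightarrow> y \<in> X \<Longrightarrow> (f ^^ k) x = (f ^^ k) y \<longleftrightarrow> x = y"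
  using inj_on_eq_iff[OF inj_f_funpow] .

lemma continuous_F: "continuous_map H.mtopology H.mtopology F"
  using continuous_map_induced_map[OF homeomorphic_imp_continuous_map[OF homeo]] .

lemma closed_invariant_H: "closed_invariant H.mtopology F H"
  using continuous_F closedin_topspace[of H.mtopology]
  by (simp add: closed_invariant_def continuous_map_def image_subset_iff_funcset)

lemma F_funpow_in: "A \<in> H \<Longrightarrow> (F ^^ k) A \<in> H"
  using closed_invariant_funpow[OF closed_invariant_H, of k] by (auto simp: closed_invariant_def)

text \<open>Every \<open>n \<ge> 1\<close> divides \<open>fact m\<close> for
  \<open>m \<ge> n\<close>; thus factorial exponents absorb each period from some stage on.\<close>

lemma fact_fixes:
  assumes "x \<in> X"
  obtains n where "\<And>m. m \<ge> n \<Longrightarrow> (f ^^ fact m) x = x"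
proof -
  obtain n where n: "n \<ge> 1" "(f ^^ n) x = x"
    using periodic assms unfolding pointwise_periodic_on_def by blast
  have "(f ^^ fact m) x = x" if "m \<ge> n" for m
  proof -
    have "fact m mod n = 0"
      using dvd_fact[of n m] n(1) that by (simp add: dvd_eq_mod_eq_0)
    then show ?thesis using funpow_mod_eq[OF n(2), of "fact m"] by simp
  qed
  then show ?thesis using that by blast
qed

lemma closedin_fixed_points: "closedin mtopology {x \<in> X. (f ^^ k) x = x}"
  using closedin_continuous_maps_eq[OF Hausdorff_space_mtopology continuous_f_funpow continuous_map_id, of k]
  by simp

section \<open>Inclusion and the uniqueness of the minimal set\<close>

text \<open>Infinitely many times \<open>r k\<close> share a residue \<open>\<rho> n\<close> modulo
  \<open>fact n\<close>, so \<open>B\<close> contains \<open>(f ^^ \<rho> n) x\<close> for each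
  \<open>x \<in> A\<close> fixed by \<open>f ^^ fact n\<close>. Applying \<open>F ^^ m n\<close>
  brings these points back, and a limit of the sets so obtained contains every point of
  \<open>A\<close>.\<close>

lemma omega_limit_superset:
  assumes A: "A \<in> H" and B: "B \<in> omega_limit H.mtopology F A"
  shows "\<exists>C \<in> omega_limit H.mtopology F B. A \<subseteq> C"
proof -
  obtain r where r: "\<And>k. k \<le> r k" and lim: "limitin H.mtopology (\<lambda>k. (F ^^ r k) A) B sequentially"
    by (rule H.omega_limitE[OF B]) (rule that)
  have BH: "B \<in> H" using H.limitin_mspace[OF lim] .
  have "\<exists>\<rho>. \<rho> < fact n \<and> infinite {k. r k mod fact n = \<rho>}" for n
    by (rule frequent_residue[of UNIV "fact n" r]) (simp_all, metis)
  then obtain \<rho> where \<rho>: "\<And>n. \<rho> n < fact n" "\<And>n. infinite {k. r k mod fact n = \<rho> n}"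
    by metis
  \<comment> \<open>\<open>m n\<close> completes \<open>\<rho> n\<close> to a multiple of
    \<open>fact n\<close>; the factor \<open>Suc n\<close> forces \<open>n \<le> m n\<close>, so the
    times tend to infinity.\<close>
  define m where "m n = fact n * Suc n - \<rho> n" for n
  have m: "m n + \<rho> n = fact n * Suc n" "n \<le> m n" for n
  proof -
    have "n + fact n \<le> fact n * Suc n" using mult_le_mono1[of 1 "fact n" n] fact_ge_1[of n] by simp
    then show "m n + \<rho> n = fact n * Suc n" "n \<le> m n"
      unfolding m_def using \<rho>(1)[of n] by linarith+
  qed
  have contains: "x \<in> (F ^^ m n) B" if x: "x \<in> A" "(f ^^ fact n) x = x" for x n
  proof -
    have xX: "x \<in> X" using x(1) hyperspaceD(3)[OF A] by blast
    have "(f ^^ \<rho> n) x \<in> B"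
    proof (rule limit_contains[OF lim f_funpow_in[OF xX]])
      have "(f ^^ \<rho> n) x \<in> (F ^^ r k) A" if "r k mod fact n = \<rho> n" for k
        using funpow_mod_eq[OF x(2), of "r k"] that x(1) by (simp add: funpow_induced_map)
      then have "{k. r k mod fact n = \<rho> n} \<subseteq> {k. (f ^^ \<rho> n) x \<in> (F ^^ r k) A}" by blast
      then show "infinite {k. (f ^^ \<rho> n) x \<in> (F ^^ r k) A}"
        using \<rho>(2)[of n] infinite_super by blast
    qed
    then have "(f ^^ m n) ((f ^^ \<rho> n) x) \<in> (F ^^ m n) B" by (simp add: funpow_induced_map)
    also have "(f ^^ m n) ((f ^^ \<rho> n) x) = (f ^^ (fact n * Suc n)) x"
      using m(1)[of n] by (metis comp_apply funpow_add)
    also have "\<dots> = x"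
      using funpow_mod_eq[OF x(2), of "fact n * Suc n"] by simp
    finally show ?thesis .
  qed
  obtain s C where s: "strict_mono s" and C: "C \<in> omega_limit H.mtopology F B"
    and limC: "limitin H.mtopology (\<lambda>k. (F ^^ m (s k)) B) C sequentially"
    by (rule H.omega_limit_sublimit[OF compact_space_hyperspace closed_invariant_H BH m(2)]) (rule that)
  have "A \<subseteq> C"
  proof
    fix x assume x: "x \<in> A"
    then have xX: "x \<in> X" using hyperspaceD(3)[OF A] by blast
    obtain n where n: "\<And>m. m \<ge> n \<Longrightarrow> (f ^^ fact m) x = x" using fact_fixes[OF xX] by metis
    have "x \<in> (F ^^ m (s k)) B" if "k \<ge> n" for k
      using contains[OF x n] strict_mono_imp_increasing[OF s, of k] that by (meson order_trans)
    then have "{n..} \<subseteq> {k. x \<in> (F ^^ m (s k)) B}" by auto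
    then have "infinite {k. x \<in> (F ^^ m (s k)) B}"
      using infinite_Ici[of n] infinite_super by blast
    then show "x \<in> C" by (rule limit_contains[OF limC xX])
  qed
  then show ?thesis using C by blast
qed

text \<open>Iterating \<open>C\<close> along the times that take \<open>A\<close> to
  \<open>B\<close> gives, after a further subsequence, a limit in \<open>N\<close>; inclusions
  survive the limit.\<close>

lemma omega_limit_bounded:
  assumes N: "closed_invariant H.mtopology F N" "C \<in> N" "A \<subseteq> C"
    and B: "B \<in> omega_limit H.mtopology F A"
  shows "\<exists>E\<in>N. B \<subseteq> E"
proof -
  obtain r where r: "\<And>k. k \<le> r k" and lim: "limitin H.mtopology (\<lambda>k. (F ^^ r k) A) B sequentially"
    by (rule H.omega_limitE[OF B]) (rule that)
  obtain s E where s: "strict_mono s" and E: "E \<in> omega_limit H.mtopology F C"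
    and limE: "limitin H.mtopology (\<lambda>k. (F ^^ r (s k)) C) E sequentially"
    by (rule H.omega_limit_sublimit[OF compact_space_hyperspace N(1,2) r]) (rule that)
  have "limitin H.mtopology (\<lambda>k. (F ^^ r (s k)) A) B sequentially"
    using limitin_subsequence[OF s lim] by (simp add: o_def)
  then have "B \<subseteq> E"
    by (rule limit_mono[OF _ limE]) (simp add: funpow_induced_map N(3) image_mono)
  moreover have "E \<in> N" using E H.omega_limit_subset[OF N(1,2)] by blast
  ultimately show ?thesis by blast
qed

lemma minimal_set_superset:
  assumes A: "A \<in> H" and M: "minimal_set H.mtopology F M" "M \<subseteq> omega_limit H.mtopology F A"
  shows "\<exists>C\<in>M. A \<subseteq> C"
proof -
  obtain B where B: "B \<in> M" using minimal_setD(1)[OF M(1)] by blast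
  then obtain C where C: "C \<in> omega_limit H.mtopology F B" "A \<subseteq> C"
    using omega_limit_superset[OF A] M(2) by blast
  then have "C \<in> M" using H.omega_limit_subset[OF minimal_setD(2)[OF M(1)] B] by blast
  then show ?thesis using C(2) by blast
qed

text \<open>Start from an inclusion-maximal \<open>C\<close> in \<open>M\<close>, dominate it by
  \<open>D\<close> in \<open>M'\<close> and \<open>D\<close> by \<open>E\<close> in
  \<open>M\<close>. Maximality forces \<open>C = D = E\<close>, so the two minimal sets
  meet.\<close>

lemma minimal_set_unique:
  assumes A: "A \<in> H"
    and M: "minimal_set H.mtopology F M" "M \<subseteq> omega_limit H.mtopology F A"
    and M': "minimal_set H.mtopology F M'" "M' \<subseteq> omega_limit H.mtopology F A"
  shows "M = M'"
proof -
  obtain C where C: "C \<in> M" "\<And>E. E \<in> M \<Longrightarrow> C \<subseteq> E \<Longrightarrow> E = C"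
    using closed_set_maximal_element[OF minimal_setD(3,1)[OF M(1)]] by metis
  obtain D0 where "D0 \<in> M'" "A \<subseteq> D0" using minimal_set_superset[OF A M'] by blast
  then obtain D where D: "D \<in> M'" "C \<subseteq> D"
    using omega_limit_bounded[OF minimal_setD(2)[OF M'(1)]] C(1) M(2) by blast
  obtain E0 where "E0 \<in> M" "A \<subseteq> E0" using minimal_set_superset[OF A M] by blast
  then obtain E where E: "E \<in> M" "D \<subseteq> E"
    using omega_limit_bounded[OF minimal_setD(2)[OF M(1)]] D(1) M'(2) by blast
  have "E = C" using C(2)[OF E(1)] D(2) E(2) by blast
  then have "C \<in> M'" using D E by (metis subset_antisym)
  then show ?thesis using minimal_set_disjoint[OF M(1) M'(1)] C(1) by blast
qed

section \<open>Infinite minimal sets\<close>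

text \<open>A minimal set of \<open>F ^^ fact n\<close> lies in every closed invariant set that it
  meets, in particular in the set of all \<open>B\<close> containing a given point of
  \<open>E\<close> fixed by \<open>f ^^ fact n\<close>. The hypothesis is symmetric, so one
  inclusion is enough.\<close>

lemma power_minimal_set_separates:
  assumes M: "M \<subseteq> H"
    and N: "\<And>i. \<exists>N. N \<subseteq> M \<and> minimal_set H.mtopology (F ^^ fact i) N \<and> E \<in> N \<and> D \<in> N"
  shows "E = D"
proof -
  have "E \<subseteq> D"
    if N: "\<And>i. \<exists>N. N \<subseteq> M \<and> minimal_set H.mtopology (F ^^ fact i) N \<and> E \<in> N \<and> D \<in> N" for E D
  proof
    fix x assume x: "x \<in> E"
    have "E \<in> H" using N[of 0] M by blast
    then have xX: "x \<in> X" using x hyperspaceD(3) by blast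
    then obtain n where n: "(f ^^ fact n) x = x" using fact_fixes by blast
    obtain N where N: "minimal_set H.mtopology (F ^^ fact n) N" "E \<in> N" "D \<in> N"
      using N[of n] by blast
    have "N \<subseteq> {B \<in> H. x \<in> B}"
    proof (rule minimal_set_subset[OF N(1)])
      have "(F ^^ fact n) B \<in> {B \<in> H. x \<in> B}" if "B \<in> {B \<in> H. x \<in> B}" for B
      proof -
        have "(f ^^ fact n) x \<in> (F ^^ fact n) B"
          using that by (simp add: funpow_induced_map)
        then show ?thesis using that F_funpow_in n by simp
      qed
      then show "closed_invariant H.mtopology (F ^^ fact n) {B \<in> H. x \<in> B}"
        using closedin_containing[OF xX] unfolding closed_invariant_def by blast
      show "N \<inter> {B \<in> H. x \<in> B} \<noteq> {}" using N(2) \<open>E \<in> H\<close> x by blast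
    qed
    then show "x \<in> D" using N(3) by blast
  qed
  from this[OF N] this[of D E] N show ?thesis by (metis subset_antisym)
qed

lemma adding_machine_if_infinite:
  assumes "minimal_set H.mtopology F M" "infinite M"
  shows "adding_machine H.mtopology F M"
proof (rule minimal_set_adding_machine[OF compact_space_hyperspace H.Hausdorff_space_mtopology continuous_F assms])
  show "fact 0 = (1 :: nat)" by simp
  show "1 \<le> (fact i :: nat)" for i by (rule fact_ge_1)
  show "(fact i :: nat) dvd fact (Suc i)" for i by (intro fact_dvd) simp
  have M: "M \<subseteq> H" using minimal_setD(5)[OF assms(1)] by simp
  show "x = y" if "\<And>i. \<exists>N. N \<subseteq> M \<and> minimal_set H.mtopology (F ^^ fact i) N \<and> x \<in> N \<and> y \<in> N" for x y
    using power_minimal_set_separates[OF M that] .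
qed

section \<open>Finite minimal sets\<close>

text \<open>Baire's theorem in the locally compact Hausdorff space \<open>C - B\<close>: it is the
  union of the closed sets \<open>G n\<close> of its points fixed by \<open>f ^^ fact n\<close>, so
  one \<open>G n\<close> has interior.\<close>

lemma locally_constant_period:
  assumes C: "C \<in> H" and B: "closedin mtopology B" and CB: "\<not> C \<subseteq> B"
  obtains n W where "openin mtopology W" "W \<inter> C \<noteq> {}" "W \<inter> B = {}"
    "\<And>x. x \<in> W \<inter> C \<Longrightarrow> (f ^^ fact n) x = x"
proof -
  define S where "S = C - B"
  define Y where "Y = subtopology mtopology S"
  have SX: "S \<subseteq> X" using hyperspaceD(3)[OF C] by (auto simp: S_def)
  have Y: "topspace Y = S" using SX by (simp add: Y_def Int_absorb1)
  have "openin mtopology (X - B)" using B by (simp add: closedin_def)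
  then have opn: "openin (subtopology mtopology C) S"
    using hyperspaceD(3)[OF C] unfolding openin_subtopology S_def by (intro exI[of _ "X - B"]) auto
  have "compact_space (subtopology mtopology C)"
    using closedin_compact_space[OF compact hyperspaceD(2)[OF C]] by (rule compact_space_subtopology)
  then have "locally_compact_space (subtopology (subtopology mtopology C) S)"
    using opn Hausdorff_space_subtopology[OF Hausdorff_space_mtopology]
    by (intro locally_compact_space_open_subset compact_imp_locally_compact_space) auto
  moreover have "subtopology (subtopology mtopology C) S = Y"
    by (simp add: subtopology_subtopology Y_def S_def Int_absorb1)
  ultimately have lc: "locally_compact_space Y" by simp
  have reg: "regular_space Y"
    using locally_compact_Hausdorff_imp_regular_space[OF lc] Hausdorff_space_subtopology[OF Hausdorff_space_mtopology]
    by (simp add: Y_def)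
  define G where "G n = S \<inter> {x \<in> X. (f ^^ fact n) x = x}" for n
  have G_closed: "closedin Y (G n)" for n
    unfolding G_def Y_def by (rule closedin_subtopology_Int_closed[OF closedin_fixed_points])
  have "(\<Union>n. G n) = S"
  proof
    show "S \<subseteq> (\<Union>n. G n)"
    proof
      fix x assume x: "x \<in> S"
      then have "x \<in> X" using SX by blast
      then obtain n where "(f ^^ fact n) x = x" using fact_fixes by blast
      then have "x \<in> G n" using x \<open>x \<in> X\<close> by (simp add: G_def)
      then show "x \<in> (\<Union>n. G n)" by blast
    qed
  qed (auto simp: G_def)
  then have "Y interior_of (\<Union>n. G n) = S"
    using interior_of_topspace[of Y] Y by simp
  moreover have "S \<noteq> {}" using CB by (auto simp: S_def)
  moreover have "Y interior_of \<Union>(range G) = {}" if "\<And>n. Y interior_of (G n) = {}"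
    by (rule Baire_category_alt) (use lc reg G_closed that in auto)
  ultimately obtain n where n: "Y interior_of (G n) \<noteq> {}" by metis
  have "openin (subtopology mtopology S) (Y interior_of (G n))"
    using openin_interior_of[of Y "G n"] by (simp only: Y_def)
  then obtain W0 where W0: "openin mtopology W0" "Y interior_of (G n) = W0 \<inter> S"
    unfolding openin_subtopology by blast
  \<comment> \<open>Removing \<open>B\<close> from \<open>W0\<close> turns the trace on
    \<open>C\<close> into the trace on \<open>S = C - B\<close>.\<close>
  have WC: "(W0 - B) \<inter> C = Y interior_of (G n)" unfolding W0(2) S_def by blast
  show ?thesis
  proof (rule that[of "W0 - B"])
    show "openin mtopology (W0 - B)" using W0(1) B by (rule openin_diff)
    show "(W0 - B) \<inter> C \<noteq> {}" using WC n by simp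
    show "(f ^^ fact n) x = x" if "x \<in> (W0 - B) \<inter> C" for x
      using subsetD[OF interior_of_subset[of Y "G n"] that[unfolded WC]] by (simp add: G_def)
  qed blast
qed

text \<open>Some \<open>C\<close> in \<open>M\<close> contains \<open>A\<close> and is periodic, so
  \<open>B\<close> lies in an iterate \<open>D\<close> of \<open>C\<close>. If \<open>D\<close> were
  larger, an open \<open>W\<close> disjoint from \<open>B\<close>, with a common period on
  \<open>W \<inter> D\<close>, would contain a point \<open>w\<close> of \<open>D\<close>; comparing
  exponents modulo \<open>N\<close> puts \<open>w\<close> in infinitely many sets
  \<open>(F ^^ b k) A\<close> and so in \<open>B\<close>.\<close>

lemma finite_minimal_set_omega_limit:
  assumes A: "A \<in> H" and M: "minimal_set H.mtopology F M" "M \<subseteq> omega_limit H.mtopology F A"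
    and fin: "finite M"
  shows "omega_limit H.mtopology F A \<subseteq> M"
proof
  fix B assume "B \<in> omega_limit H.mtopology F A"
  then obtain b where limB: "limitin H.mtopology (\<lambda>k. (F ^^ b k) A) B sequentially"
    by (rule H.omega_limitE) (rule that)
  have BH: "B \<in> H" using H.limitin_mspace[OF limB] .
  obtain C where C: "C \<in> M" "A \<subseteq> C" using minimal_set_superset[OF A M] by blast
  then have "C \<in> omega_limit H.mtopology F A" using M(2) by blast
  then obtain c where limC: "limitin H.mtopology (\<lambda>k. (F ^^ c k) A) C sequentially"
    by (rule H.omega_limitE) (rule that)
  have CH: "C \<in> H" using H.limitin_mspace[OF limC] .
  have CX: "C \<subseteq> X" using hyperspaceD(3)[OF CH] .
  have FM: "(F ^^ k) C \<in> M" for k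
    using closed_invariant_funpow[OF minimal_setD(2)[OF M(1)], of k] C(1)
    by (auto simp: closed_invariant_def)
  have "\<not> inj (\<lambda>k. (F ^^ k) C)"
    using finite_subset[OF _ fin, of "range (\<lambda>k. (F ^^ k) C)"] FM range_inj_infinite by blast
  then obtain i j where ij: "i < j" "(F ^^ i) C = (F ^^ j) C"
    unfolding inj_def by (metis linorder_neqE_nat)
  define p where "p = j - i"
  have p: "p \<ge> 1" using ij(1) by (simp add: p_def)
  \<comment> \<open>Injectivity of \<open>f ^^ i\<close> on \<open>X\<close> turns the repetition
    into a return of \<open>C\<close> itself.\<close>
  have "(f ^^ i) ` (f ^^ p) ` C = (f ^^ i) ` C"
    using ij funpow_image_add[of i p f C] by (simp add: p_def funpow_induced_map)
  then have "(f ^^ p) ` C = C"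
    using inj_on_image_eq_iff[OF inj_f_funpow[of i]] CX f_funpow_in by (metis image_subset_iff subsetD)
  then have FpC: "(F ^^ p) C = C" by (simp add: funpow_induced_map)
  have mod_p: "(F ^^ k) C = (F ^^ l) C" if "k mod p = l mod p" for k l
    using funpow_mod_eq[OF FpC] that by metis
  have sub: "(F ^^ k) A \<subseteq> (F ^^ k) C" for k
    using C(2) by (simp add: funpow_induced_map image_mono)
  \<comment> \<open>Along times \<open>b k\<close> in one residue class modulo \<open>p\<close>, the
    iterates of \<open>A\<close> all lie in the same iterate of \<open>C\<close>.\<close>
  obtain r0 where r0: "infinite {k \<in> UNIV. b k mod p = r0}"
    by (rule frequent_residue[OF infinite_UNIV_nat p]) (rule that)
  have "\<exists>k. b k mod p = r0"
    using infinite_imp_nonempty[OF r0] by blast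
  then have r0_mod: "r0 mod p = r0" by auto
  define D where "D = (F ^^ r0) C"
  have DH: "D \<in> H" unfolding D_def by (rule F_funpow_in[OF CH])
  have "B \<subseteq> D"
  proof (rule limit_subset[OF limB hyperspaceD(2)[OF DH]])
    have "(F ^^ b k) A \<subseteq> D" if "b k mod p = r0" for k
      using sub[of "b k"] mod_p[of "b k" r0] that r0_mod by (simp add: D_def)
    then have "{k \<in> UNIV. b k mod p = r0} \<subseteq> {k. (F ^^ b k) A \<subseteq> D}" by blast
    then show "infinite {k. (F ^^ b k) A \<subseteq> D}" using r0 infinite_super by blast
  qed
  moreover have "D \<subseteq> B"
  proof (rule ccontr)
    assume "\<not> D \<subseteq> B"
    then obtain n W where W: "openin mtopology W" "W \<inter> D \<noteq> {}" "W \<inter> B = {}"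
      and W_fix: "\<And>x. x \<in> W \<inter> D \<Longrightarrow> (f ^^ fact n) x = x"
      by (rule locally_constant_period[OF DH hyperspaceD(2)[OF BH]]) (rule that)
    \<comment> \<open>A common multiple of \<open>p\<close> and \<open>fact n\<close>: residues
      modulo \<open>N\<close> determine both the iterates of \<open>C\<close> and those of points in
      \<open>W \<inter> D\<close>.\<close>
    define N where "N = p * fact n"
    have N: "N \<ge> 1" "p dvd N" using p by (simp_all add: N_def Suc_leI)
    have WN: "(f ^^ N) w = w" if "w \<in> W \<inter> D" for w
      using funpow_mod_eq[OF W_fix[OF that], of N] by (simp add: N_def)
    obtain r where r: "r < N" "infinite {k \<in> {k \<in> UNIV. b k mod p = r0}. b k mod N = r}"
      by (rule frequent_residue[OF r0 N(1)]) (rule that)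
    then obtain k where k: "b k mod p = r0" "b k mod N = r"
      using infinite_imp_nonempty[OF r(2)] by blast
    have r_mod: "r mod p = r0"
      using k mod_mod_cancel[OF N(2), of "b k"] by simp
    obtain s where s: "s < N" "infinite {k \<in> UNIV. c k mod N = s}"
      by (rule frequent_residue[OF infinite_UNIV_nat N(1)]) (rule that)
    have c_s: "(F ^^ c k) C = (F ^^ s) C" if "c k mod N = s" for k
    proof (rule mod_p)
      show "c k mod p = s mod p" using that mod_mod_cancel[OF N(2), of "c k"] by simp
    qed
    \<comment> \<open>As a limit of sets inside \<open>(F ^^ s) C\<close>, the set \<open>C\<close>
      lies in it; iterating the inclusion leads to \<open>(F ^^ (s * p)) C = C\<close>, which forces
      equality.\<close>
    have C_s: "(F ^^ s) C = C"
    proof -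
      have step: "C \<subseteq> (F ^^ s) C"
      proof (rule limit_subset[OF limC hyperspaceD(2)[OF F_funpow_in[OF CH]]])
        have "(F ^^ c k) A \<subseteq> (F ^^ s) C" if "c k mod N = s" for k
          using sub[of "c k"] c_s[OF that] by simp
        then have "{k \<in> UNIV. c k mod N = s} \<subseteq> {k. (F ^^ c k) A \<subseteq> (F ^^ s) C}" by blast
        then show "infinite {k. (F ^^ c k) A \<subseteq> (F ^^ s) C}" using s(2) infinite_super by blast
      qed
      have up: "(F ^^ s) C \<subseteq> (F ^^ (s * Suc m)) C" for m
      proof (induction m)
        case (Suc m)
        have "(F ^^ s) C \<subseteq> (f ^^ s) ` (F ^^ s) C"
          using step by (subst funpow_induced_map) (rule image_mono)
        also have "\<dots> \<subseteq> (f ^^ s) ` (F ^^ (s * Suc m)) C" using Suc by (rule image_mono)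
        also have "\<dots> = (F ^^ (s * Suc (Suc m))) C"
          by (simp only: funpow_induced_map mult_Suc_right[of s "Suc m"] funpow_image_add)
        finally show ?case .
      qed simp
      have "(F ^^ s) C \<subseteq> (F ^^ (s * p)) C" using up[of "p - 1"] p by simp
      also have "\<dots> = C" using mod_p[of "s * p" 0] by simp
      finally show ?thesis using step by blast
    qed
    \<comment> \<open>Modulo \<open>N\<close> this is \<open>s - r\<close>; the summand
      \<open>N * r\<close> keeps the subtraction from truncating. Since
      \<open>D = (F ^^ r) C\<close>, the iterate \<open>f ^^ j\<close> carries \<open>D\<close> onto
      \<open>C\<close>.\<close>
    define j where "j = s + N * r - r"
    have j: "j + r = s + N * r"
      unfolding j_def using mult_le_mono1[OF N(1), of r] by linarith
    have jD: "(f ^^ j) ` D = C"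
    proof -
      have "D = (F ^^ r) C" unfolding D_def by (rule mod_p) (simp add: r_mod r0_mod)
      then have "(f ^^ j) ` D = (F ^^ (s + N * r)) C"
        by (simp add: funpow_induced_map flip: funpow_image_add j)
      also have "\<dots> = (F ^^ s) C"
      proof (rule mod_p)
        have "p dvd N * r" using N(2) by simp
        then show "(s + N * r) mod p = s mod p" by (metis mod_add_right_eq add.right_neutral dvd_eq_mod_eq_0)
      qed
      finally show ?thesis using C_s by simp
    qed
    have DX: "D \<subseteq> X" using hyperspaceD(3)[OF DH] .
    have WX: "W \<subseteq> X" using openin_subset[OF W(1)] by simp
    have "openin mtopology ((f ^^ j) ` W)"
      using homeomorphic_imp_open_map[OF homeomorphic_map_f_funpow] W(1) by (simp add: open_map_def)
    then have "openin H.mtopology {E \<in> H. E \<inter> (f ^^ j) ` W \<noteq> {}}" by (rule openin_hit)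
    moreover have "C \<in> {E \<in> H. E \<inter> (f ^^ j) ` W \<noteq> {}}"
      using CH W(2) jD by blast
    ultimately have ev: "eventually (\<lambda>k. (F ^^ c k) A \<in> {E \<in> H. E \<inter> (f ^^ j) ` W \<noteq> {}}) sequentially"
      using limC unfolding limitin_def by blast
    \<comment> \<open>The limit \<open>C\<close> meets the open image of \<open>W\<close> under
      \<open>f ^^ j\<close>, so all late \<open>(F ^^ c k) A\<close> do; infinitely many
      \<open>c k\<close> have residue \<open>s\<close>.\<close>
    have "\<exists>k. c k mod N = s \<and> (F ^^ c k) A \<inter> (f ^^ j) ` W \<noteq> {}"
    proof -
      obtain k0 where k0: "\<And>k. k \<ge> k0 \<Longrightarrow> (F ^^ c k) A \<inter> (f ^^ j) ` W \<noteq> {}"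
        using ev unfolding eventually_sequentially by blast
      obtain k where "k \<ge> k0" "c k mod N = s"
        using s(2) unfolding infinite_nat_iff_unbounded_le by blast
      then show ?thesis using k0 by blast
    qed
    then obtain l a w where l: "c l mod N = s" and a: "a \<in> A" and w: "w \<in> W" "(f ^^ c l) a = (f ^^ j) w"
      unfolding funpow_induced_map by blast
    have aX: "a \<in> X" using a C(2) CX by blast
    have wX: "w \<in> X" using w(1) WX by blast
    have "(f ^^ j) w \<in> (f ^^ j) ` D"
    proof -
      have "(f ^^ c l) a \<in> (F ^^ c l) C" using a C(2) by (auto simp: funpow_induced_map)
      then show ?thesis using w(2) c_s[OF l] C_s jD by simp
    qed
    then have wD: "w \<in> W \<inter> D"
      using inj_on_image_mem_iff[OF inj_f_funpow wX DX] w(1) by blast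
    \<comment> \<open>The point \<open>a\<close> inherits the period \<open>N\<close> from
      \<open>w\<close>, as iterates commute and \<open>f ^^ c l\<close> is injective on
      \<open>X\<close>.\<close>
    have "(f ^^ c l) ((f ^^ N) a) = (f ^^ N) ((f ^^ j) w)"
      by (simp add: funpow_commuting_apply[of "c l" f N a] w(2))
    also have "\<dots> = (f ^^ c l) a"
      by (simp add: funpow_commuting_apply[of N f j w] WN[OF wD] w(2))
    finally have aN: "(f ^^ N) a = a"
      using f_funpow_inject[OF f_funpow_in[OF aX] aX] by simp
    \<comment> \<open>Modulo \<open>N\<close> both \<open>c l\<close> and \<open>j + r\<close>
      reduce to \<open>s\<close>, and \<open>f ^^ s\<close> can be cancelled.\<close>
    have "(f ^^ s) ((f ^^ r) a) = (f ^^ r) ((f ^^ c l) a)"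
      using funpow_mod_eq[OF aN, of "c l"] l by (simp add: funpow_commuting_apply[of s f r a])
    also have "\<dots> = (f ^^ (s + N * r)) w"
      by (simp add: w(2) funpow_add flip: j) (rule funpow_commuting_apply)
    also have "\<dots> = (f ^^ s) w"
      using funpow_mod_eq[OF WN[OF wD], of "N * r"] by (simp add: funpow_add)
    finally have aw: "(f ^^ r) a = w"
      using f_funpow_inject[OF f_funpow_in[OF aX] wX] by simp
    have "w \<in> B"
    proof (rule limit_contains[OF limB wX])
      \<comment> \<open>Every time \<open>b k\<close> with residue \<open>r\<close> sends the point
        \<open>a\<close> of \<open>A\<close> to \<open>w\<close>.\<close>
      have "w \<in> (F ^^ b k) A" if "b k mod N = r" for k
        using funpow_mod_eq[OF aN, of "b k"] that aw a by (auto simp: funpow_induced_map)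
      then have "{k \<in> {k \<in> UNIV. b k mod p = r0}. b k mod N = r} \<subseteq> {k. w \<in> (F ^^ b k) A}" by blast
      then show "infinite {k. w \<in> (F ^^ b k) A}" using r(2) infinite_super by blast
    qed
    then show False using w(1) W(3) by blast
  qed
  ultimately have "B = D" by blast
  then show "B \<in> M" using FM by (simp add: D_def)
qed

lemma omega_limit_minimal_set:
  assumes A: "A \<in> H"
  obtains M where "M \<subseteq> omega_limit H.mtopology F A" "minimal_set H.mtopology F M"
proof (rule minimal_set_exists[OF compact_space_hyperspace H.closed_invariant_omega_limit[OF continuous_F]])
  obtain C where "C \<in> omega_limit H.mtopology F A"
    by (rule H.omega_limit_sublimit[OF compact_space_hyperspace closed_invariant_H A order_refl]) (rule that)
  then show "omega_limit H.mtopology F A \<noteq> {}" by blast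
qed (rule that)

end

theorem theorem5p1:
  fixes X :: "'a set" and d :: "'a \<Rightarrow> 'a \<Rightarrow> real" and f :: "'a \<Rightarrow> 'a" and A :: "'a set"
  assumes "Metric_space X d"
    and "compact_space (Metric_space.mtopology X d)"
    and "homeomorphic_map (Metric_space.mtopology X d) (Metric_space.mtopology X d) f"
    and "pointwise_periodic_on X f"
    and "A \<in> hyperspace X d"
  shows "let Z = hyperspace_topology X d;
             \<Omega> = omega_limit Z (induced_map f) A
         in (\<exists>!M. M \<subseteq> \<Omega> \<and> minimal_set Z (induced_map f) M) \<and>
            (\<forall>M. M \<subseteq> \<Omega> \<and> minimal_set Z (induced_map f) M \<longrightarrow>
               (finite \<Omega> \<longleftrightarrow> finite M) \<and>
               (infinite \<Omega> \<longrightarrow> adding_machine Z (induced_map f) M))"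
proof -
  interpret pointwise_periodic_system X d f
    using assms(1-4)
    by (simp add: pointwise_periodic_system_def pointwise_periodic_system_axioms_def
        hyperspace_compact_def hyperspace_compact_axioms_def)
  let ?\<Omega> = "omega_limit H.mtopology F A"
  obtain M0 where "M0 \<subseteq> ?\<Omega>" "minimal_set H.mtopology F M0"
    by (rule omega_limit_minimal_set[OF assms(5)]) (rule that)
  then have "\<exists>!M. M \<subseteq> ?\<Omega> \<and> minimal_set H.mtopology F M"
    using minimal_set_unique[OF assms(5)] by (intro ex1I[of _ M0]) auto
  moreover have "(finite ?\<Omega> \<longleftrightarrow> finite M) \<and> (infinite ?\<Omega> \<longrightarrow> adding_machine H.mtopology F M)"
    if M: "M \<subseteq> ?\<Omega>" "minimal_set H.mtopology F M" for M
  proof -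
    \<comment> \<open>A finite \<open>M\<close> contains all of \<open>?\<Omega>\<close>; so an
      infinite \<open>?\<Omega>\<close> forces \<open>M\<close> to be infinite as well.\<close>
    have "finite ?\<Omega> \<longleftrightarrow> finite M"
      using finite_subset[OF M(1)] finite_subset[OF finite_minimal_set_omega_limit[OF assms(5) M(2,1)]]
      by blast
    then show ?thesis using adding_machine_if_infinite[OF M(2)] by blast
  qed
  ultimately show ?thesis
    unfolding hyperspace_topology_def Let_def by blast
qed

end
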